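(* Let $x_0$, $x_{ij}$ ($1\le i<j\le5$), $y_i,a_i,b_i$ ($1\le i\le 5$), $w$ be $27$ variables over $\mathbb{C}$, and let $P$ be the skew-symmetric $5\times5$ matrix with $(i,j)$ entry $x_{ij}$ for $i<j$. For $1\le i\le 5$ let $$q_i=x_0y_i+(-1)^{i-1}\operatorname{Pf}(P,i),\qquad q_i'=(y_1,y_2,y_3,y_4,y_5)\,P_i,$$ where $\operatorname{Pf}(P,i)$ is the Pfaffian of the $4\times4$ matrix obtained by deleting the $i$-th row and column of $P$, and $P_i$ is the $i$-th column of $P$. Put $$F=\sum_{i=1}^5(q_ia_i+q_i'b_i),\qquad F_{\mathcal{C}}=F-\Big(\sum_{i=1}^5a_ib_i\Big)w .$$ Then: (1) The hypersurface $V(F_{\mathcal{C}})$ is the Cartan cubic hypersurface $\mathcal{C}$ in $\mathbb{P}^{26}$, and the hypersurface $V(F)\subset V(w)=\mathbb{P}^{25}$ is its hyperplane section. (2) The singular locus of $V(F)$ is the union of a hyperplane section of the Cayley plane $\mathbb{OP}^2\subset\mathbb{P}^{26}$ and an embedded component $\Lambda\cong\mathbb{P}^9$, where $\Lambda\subset V(w)=\mathbb{P}^{25}$ is the linear subspace cut out by the $16$ variables $x_0,x_{ij},y_i$.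
   Context: The ground field is $\mathbb{C}$. $V(F_{\mathcal{C}})$ is taken in $\mathbb{P}^{26}$ with the $27$ homogeneous coordinates $x_0,x_{ij},y_i,a_i,b_i,w$; the form $F$ involves only the $26$ variables other than $w$, and $V(F)$ is regarded as a hypersurface in the hyperplane $V(w)=\mathbb{P}^{25}$. Cartan cubic and Cayley plane: the Lie group $E_6$ acts on its $27$-dimensional minimal irreducible representation $V_{27}$, and there are exactly three orbits in $\mathbb{P}(V_{27})=\mathbb{P}^{26}$: the unique closed orbit, called the Cayley plane $\mathbb{OP}^2=E_6/P_1$ (the Severi variety of dimension $16$); the set $\mathcal{C}\setminus\mathbb{OP}^2$; and the dense open orbit $\mathbb{P}^{26}\setminus\mathcal{C}$. Here $\mathcal{C}\subset\mathbb{P}^{26}$ is the $E_6$-invariant cubic hypersurface called the Cartan cubic. It is the secant variety of the Cayley plane, and its singular locus is the Cayley plane. That $V(F_{\mathcal{C}})$ is the Cartan cubic is understood under a suitable linear identification of the coordinate space $\mathbb{C}^{27}$ with $V_{27}$, with $\mathbb{OP}^2$ the corresponding Cayley plane. The singular locus of $V(F)\subset\mathbb{P}^{25}$ is the locus defined by the Jacobian ideal of $F$, generated by its $26$ partial derivatives with respect to the variables $x_0,x_{ij},y_i,a_i,b_i$. *)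

theory Defs
  imports "HOL-Analysis.Analysis"
begin

section \<open>The 27 variables\<close>

datatype label = Lx0 | Lx nat nat | Ly nat | La nat | Lb nat | Lw

definition labels :: "label set" where
  "labels = {Lx0, Lw} \<union> {Lx i j | i j. 1 \<le> i \<and> i < j \<and> j \<le> 5}
     \<union> Ly ` {1..5} \<union> La ` {1..5} \<union> Lb ` {1..5}"

typedef coord = labels
  by (rule exI[of _ Lx0]) (simp add: labels_def)

lemma labels_eq:
  "labels = {Lx0, Lw,
     Lx 1 2, Lx 1 3, Lx 1 4, Lx 1 5, Lx 2 3, Lx 2 4, Lx 2 5, Lx 3 4, Lx 3 5, Lx 4 5,
     Ly 1, Ly 2, Ly 3, Ly 4, Ly 5, La 1, La 2, La 3, La 4, La 5, Lb 1, Lb 2, Lb 3, Lb 4, Lb 5}"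
  (is "_ = ?R")
proof -
  have x: "{Lx i j | i j. 1 \<le> i \<and> i < j \<and> j \<le> 5} =
      {Lx 1 2, Lx 1 3, Lx 1 4, Lx 1 5, Lx 2 3, Lx 2 4, Lx 2 5, Lx 3 4, Lx 3 5, Lx 4 5}"
    (is "?L = ?X")
  proof
    show "?L \<subseteq> ?X"
    proof
      fix l
      assume "l \<in> ?L"
      then obtain i j :: nat where l: "l = Lx i j" and ij: "1 \<le> i" "i < j" "j \<le> 5"
        by blast
      then have i: "i = 1 \<or> i = 2 \<or> i = 3 \<or> i = 4" and j: "j = 2 \<or> j = 3 \<or> j = 4 \<or> j = 5"
        by linarith+
      then show "l \<in> ?X"
        using l \<open>i < j\<close> by auto
    qed
    show "?X \<subseteq> ?L" by auto
  qed
  have s: "{1..5::nat} = {1, 2, 3, 4, 5}" by auto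
  show ?thesis unfolding labels_def x s image_insert image_empty by blast
qed

lemma card_labels: "card labels = 27"
  by (simp add: labels_eq)

instance coord :: finite
proof
  have "finite labels" by (simp add: labels_eq)
  then show "finite (UNIV :: coord set)"
    using type_definition.Abs_image[OF type_definition_coord] finite_imageI by metis
qed

lemma card_coord: "CARD(coord) = 27"
  using type_definition.card[OF type_definition_coord] card_labels by simp

type_synonym cvec = "complex ^ coord"
type_synonym cmat = "complex ^ coord ^ coord"

text \<open>The value of the variable with a given label; only labels in \<open>labels\<close> are meaningful.\<close>

definition var :: "label \<Rightarrow> cvec \<Rightarrow> complex" where
  "var l v = v $ Abs_coord l"


section \<open>The cubic forms\<close>

definition P_entry :: "cvec \<Rightarrow> nat \<Rightarrow> nat \<Rightarrow> complex" where
  "P_entry v i j =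
     (if i < j then var (Lx i j) v else if j < i then - var (Lx j i) v else 0)"

text \<open>\<open>skip i\<close> enumerates the indices other than \<open>i\<close> increasingly.\<close>

definition skip :: "nat \<Rightarrow> nat \<Rightarrow> nat" where
  "skip i k = (if k < i then k else k + 1)"

definition pfaffian4 :: "(nat \<Rightarrow> nat \<Rightarrow> complex) \<Rightarrow> complex" where
  "pfaffian4 M = M 1 2 * M 3 4 - M 1 3 * M 2 4 + M 1 4 * M 2 3"

definition Pf :: "cvec \<Rightarrow> nat \<Rightarrow> complex" where
  "Pf v i = pfaffian4 (\<lambda>k l. P_entry v (skip i k) (skip i l))"

definition q :: "nat \<Rightarrow> cvec \<Rightarrow> complex" where
  "q i v = var Lx0 v * var (Ly i) v + (-1) ^ (i - 1) * Pf v i"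

definition q' :: "nat \<Rightarrow> cvec \<Rightarrow> complex" where
  "q' i v = (\<Sum>j = 1..5. var (Ly j) v * P_entry v j i)"

definition F :: "cvec \<Rightarrow> complex" where
  "F v = (\<Sum>i = 1..5. q i v * var (La i) v + q' i v * var (Lb i) v)"

definition F_C :: "cvec \<Rightarrow> complex" where
  "F_C v = F v - (\<Sum>i = 1..5. var (La i) v * var (Lb i) v) * var Lw v"


section \<open>Projective space and its Zariski topology\<close>

text \<open>Points of the 26-dimensional projective space are one-dimensional subspaces.\<close>

type_synonym point = "cvec set"

definition PP :: "point set" where
  "PP = {vec.span {v} | v. v \<noteq> 0}"

definition homogeneous :: "nat \<Rightarrow> (cvec \<Rightarrow> complex) \<Rightarrow> bool" where
  "homogeneous d f \<longleftrightarrow>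
     (\<exists>c :: (coord \<Rightarrow> nat) \<Rightarrow> complex.
        \<forall>v. f v = (\<Sum>m \<in> {m. (\<Sum>k\<in>UNIV. m k) = d}. c m * (\<Prod>k\<in>UNIV. (v $ k) ^ m k)))"

definition zero_locus :: "(cvec \<Rightarrow> complex) set \<Rightarrow> point set" where
  "zero_locus S = {L \<in> PP. \<forall>f\<in>S. \<forall>v\<in>L. f v = 0}"

abbreviation V :: "(cvec \<Rightarrow> complex) \<Rightarrow> point set" where
  "V f \<equiv> zero_locus {f}"

definition zariski_closed :: "point set \<Rightarrow> bool" where
  "zariski_closed Z \<longleftrightarrow> (\<exists>S. (\<forall>f\<in>S. \<exists>d. homogeneous d f) \<and> Z = zero_locus S)"

definition zariski_irreducible :: "point set \<Rightarrow> bool" where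
  "zariski_irreducible Z \<longleftrightarrow> Z \<noteq> {} \<and>
     (\<forall>Z1 Z2. zariski_closed Z1 \<longrightarrow> zariski_closed Z2 \<longrightarrow> Z \<subseteq> Z1 \<union> Z2 \<longrightarrow> Z \<subseteq> Z1 \<or> Z \<subseteq> Z2)"

definition irreducible_component :: "point set \<Rightarrow> point set \<Rightarrow> bool" where
  "irreducible_component Z S \<longleftrightarrow>
     zariski_closed Z \<and> zariski_irreducible Z \<and> Z \<subseteq> S \<and>
     (\<forall>Z'. zariski_closed Z' \<longrightarrow> zariski_irreducible Z' \<longrightarrow> Z \<subseteq> Z' \<longrightarrow> Z' \<subseteq> S \<longrightarrow> Z' = Z)"

definition cubic_hypersurface :: "point set \<Rightarrow> bool" where
  "cubic_hypersurface Z \<longleftrightarrow> (\<exists>f. homogeneous 3 f \<and> (\<exists>v. f v \<noteq> 0) \<and> Z = V f)"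

definition projective_linear :: "nat \<Rightarrow> point set \<Rightarrow> bool" where
  "projective_linear n Z \<longleftrightarrow>
     (\<exists>U :: cvec set. vec.subspace U \<and> vec.dim U = n + 1 \<and> Z = {L \<in> PP. L \<subseteq> U})"


section \<open>The group of type E6 and its 27-dimensional representation\<close>

text \<open>Nodes \<open>1..6\<close> of the Dynkin diagram, in Bourbaki's numbering.\<close>

definition E6_cartan :: "nat \<Rightarrow> nat \<Rightarrow> int" where
  "E6_cartan i j =
     (if i = j then 2
      else if {i, j} \<in> {{1, 3}, {3, 4}, {4, 5}, {5, 6}, {2, 4}} then - 1 else 0)"

definition bracket :: "cmat \<Rightarrow> cmat \<Rightarrow> cmat" where
  "bracket M N = M ** N - N ** M"

text \<open>
  By Serre's theorem, matrices \<open>e i, f i, h i\<close> satisfying the six relations below are the same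
  thing as a representation of the complex simple Lie algebra of type E6 on \<open>cvec\<close>.  Up to
  isomorphism and the diagram automorphism (which does not change the group below), there is
  exactly one irreducible representation of dimension 27.  Hence giving such matrices amounts to
  identifying the coordinate space linearly with that representation.  Note that \<open>mat c ** M\<close> is
  the scalar multiple of \<open>M\<close> by \<open>c\<close>.
\<close>

definition E6_rep27 :: "(nat \<Rightarrow> cmat) \<Rightarrow> (nat \<Rightarrow> cmat) \<Rightarrow> (nat \<Rightarrow> cmat) \<Rightarrow> bool" where
  "E6_rep27 e f h \<longleftrightarrow>
     (\<forall>i\<in>{1..6}. \<forall>j\<in>{1..6}.
        bracket (h i) (h j) = 0 \<and>
        bracket (e i) (f j) = (if i = j then h i else 0) \<and>
        bracket (h i) (e j) = mat (of_int (E6_cartan i j)) ** e j \<and>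
        bracket (h i) (f j) = mat (of_int (- E6_cartan i j)) ** f j \<and>
        (i \<noteq> j \<longrightarrow> (bracket (e i) ^^ nat (1 - E6_cartan i j)) (e j) = 0) \<and>
        (i \<noteq> j \<longrightarrow> (bracket (f i) ^^ nat (1 - E6_cartan i j)) (f j) = 0)) \<and>
     (\<forall>U :: cvec set. vec.subspace U \<longrightarrow>
        (\<forall>i\<in>{1..6}. \<forall>v\<in>U. e i *v v \<in> U \<and> f i *v v \<in> U \<and> h i *v v \<in> U) \<longrightarrow>
        U = {0} \<or> U = UNIV)"

inductive_set lie_algebra :: "cmat set \<Rightarrow> cmat set" for S :: "cmat set" where
  generator: "M \<in> S \<Longrightarrow> M \<in> lie_algebra S"
| zero: "0 \<in> lie_algebra S"
| add: "M \<in> lie_algebra S \<Longrightarrow> N \<in> lie_algebra S \<Longrightarrow> M + N \<in> lie_algebra S"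
| scale: "M \<in> lie_algebra S \<Longrightarrow> mat c ** M \<in> lie_algebra S"
| bracket: "M \<in> lie_algebra S \<Longrightarrow> N \<in> lie_algebra S \<Longrightarrow> bracket M N \<in> lie_algebra S"

definition mat_exp :: "cmat \<Rightarrow> cmat" where
  "mat_exp M = (\<Sum>n. (((**) M) ^^ n) (mat 1) /\<^sub>R fact n)"

text \<open>
  The connected Lie subgroup of the general linear group with a given Lie algebra \<open>g\<close> is the
  subgroup generated by the exponentials; it is closed under inverses as \<open>g\<close> is under negation.
\<close>

inductive_set exp_group :: "cmat set \<Rightarrow> cmat set" for g :: "cmat set" where
  one: "mat 1 \<in> exp_group g"
| mult: "M \<in> g \<Longrightarrow> N \<in> exp_group g \<Longrightarrow> mat_exp M ** N \<in> exp_group g"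

definition E6_group :: "(nat \<Rightarrow> cmat) \<Rightarrow> (nat \<Rightarrow> cmat) \<Rightarrow> (nat \<Rightarrow> cmat) \<Rightarrow> cmat set" where
  "E6_group e f h = exp_group (lie_algebra (e ` {1..6} \<union> f ` {1..6} \<union> h ` {1..6}))"

definition act :: "cmat \<Rightarrow> point \<Rightarrow> point" where
  "act g L = (\<lambda>v. g *v v) ` L"

definition orbits :: "cmat set \<Rightarrow> point set set" where
  "orbits G = {{act g L | g. g \<in> G} | L. L \<in> PP}"

text \<open>The unique closed orbit.\<close>

definition is_Cayley_plane :: "cmat set \<Rightarrow> point set \<Rightarrow> bool" where
  "is_Cayley_plane G Z \<longleftrightarrow> {Z' \<in> orbits G. zariski_closed Z'} = {Z}"

text \<open>The invariant cubic hypersurface (for the E6 group on its 27-dimensional irreducible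
  representation there is only one).\<close>

definition is_Cartan_cubic :: "cmat set \<Rightarrow> point set \<Rightarrow> bool" where
  "is_Cartan_cubic G Z \<longleftrightarrow> cubic_hypersurface Z \<and> (\<forall>g\<in>G. act g ` Z = Z)"


section \<open>The hypersurface V(F) in the hyperplane V(w)\<close>

definition partial :: "coord \<Rightarrow> (cvec \<Rightarrow> complex) \<Rightarrow> cvec \<Rightarrow> complex" where
  "partial k f v = deriv (\<lambda>t. f (v + t *s axis k 1)) 0"

text \<open>The form \<open>F\<close> does not involve the variable \<open>w\<close>, so the hypersurface it defines in the
  hyperplane \<open>V(w)\<close>, with the remaining 26 homogeneous coordinates, is the following set.\<close>

definition V_F :: "point set" where
  "V_F = zero_locus {var Lw, F}"

definition Sing_V_F :: "point set" where
  "Sing_V_F = zero_locus ({var Lw} \<union> {partial k F | k. k \<noteq> Abs_coord Lw})"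

text \<open>This subspace contains points with nonzero sum of the products of \<open>La i\<close> and \<open>Lb i\<close>,
  which do not lie on the Cayley plane.  So as a component of the singular locus it is not embedded
  in the sense of primary decomposition, but an irreducible component that is a linearly embedded
  projective space.\<close>

definition Lam :: "point set" where
  "Lam = zero_locus ({var Lw, var Lx0} \<union> {var (Lx i j) | i j. 1 \<le> i \<and> i < j \<and> j \<le> 5}
     \<union> {var (Ly i) | i. 1 \<le> i \<and> i \<le> 5})"

end

theory Submission
  imports Defs
begin

text \<open>
  The \<open>D5\<close> subdiagram of \<open>E6\<close> splits the 27 variables into the spinor \<open>s = (x0, x, y)\<close> in a half-spin
  representation of \<open>so(10)\<close>, the vector \<open>(a, b)\<close> with quadratic form \<open>\<Sum>i. a i * b i\<close>, and the
  invariant coordinate \<open>w\<close>.  The forms \<open>q i\<close> and \<open>q' i\<close> are the components of the equivariant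
  quadratic map from spinors to vectors, so \<open>F_C\<close> is the pairing of this map with the vector, minus the
  quadratic form times \<open>w\<close>.  Explicit Chevalley generators (\<open>e6\<close>, \<open>f6\<close>, \<open>h6\<close>) are written down in these
  coordinates; the Serre relations and the invariance of \<open>F_C\<close> under the generators are finite
  computations, and the invariance passes to brackets (\<open>annihilates_lie_algebra\<close>) and, because
  \<open>exp (t M) v\<close> solves \<open>x' = M x\<close>, to the group (\<open>cubic_polar_invariant\<close>).  The representation is
  irreducible since the 27 weights are different and connected by the generators.

  The Cayley plane is taken as the singular locus of \<open>V F_C\<close>, which is closed and invariant.  It is a single
  orbit (\<open>cayley_orbit\<close>): by irreducibility the group moves every point into the chart \<open>w \<noteq> 0\<close>, and
  there the vanishing of the derivatives by \<open>a\<close> and \<open>b\<close> expresses the vector part through \<open>w\<close> and \<open>s\<close>,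
  which is also what the exponentials of the 16-dimensional abelian nilradical produce from the highest
  weight point.  No other orbit is closed, because a generic one-parameter group of diagonal matrices contracts
  any point to a coordinate point in the closure of its orbit, and coordinate points are singular
  (\<open>closed_invariant_meets_cayley\<close>).

  On \<open>w = 0\<close> the derivatives of \<open>F\<close> are those of \<open>F_C\<close>, except that the derivative of \<open>F_C\<close> by \<open>w\<close>, which
  is \<open>- (\<Sum>i. a i * b i)\<close>, is missing.  A singular point of \<open>V_F\<close> at which this sum vanishes lies on the
  Cayley plane.  At any other one, the derivatives by the spinor variables say that Clifford
  multiplication by an anisotropic vector kills the spinor, so the spinor is 0 and the point lies in \<open>Lam\<close>
  (\<open>clifford_kernel\<close>).  Finally \<open>Lam\<close> is irreducible, being linear, and contains points outside the Cayley
  plane, so it is a component.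
\<close>


section \<open>Coordinates\<close>

lemma label_memberships [simp]:
  "Lx0 \<in> labels" "Lw \<in> labels"
  "Lx i j \<in> labels \<longleftrightarrow> 1 \<le> i \<and> i < j \<and> j \<le> 5"
  "Ly i \<in> labels \<longleftrightarrow> 1 \<le> i \<and> i \<le> 5"
  "La i \<in> labels \<longleftrightarrow> 1 \<le> i \<and> i \<le> 5"
  "Lb i \<in> labels \<longleftrightarrow> 1 \<le> i \<and> i \<le> 5"
  by (auto simp: labels_def)

text \<open>The inverse of reading off the variables: labels outside \<open>labels\<close> are ignored.\<close>

definition vec_of :: "(label \<Rightarrow> complex) \<Rightarrow> cvec" where
  "vec_of g = (\<chi> k. g (Rep_coord k))"

abbreviation unit :: "label \<Rightarrow> cvec" where
  "unit l \<equiv> axis (Abs_coord l) 1"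

definition spinor_labels :: "label set" where
  "spinor_labels = {Lx0} \<union> {Lx i j | i j. 1 \<le> i \<and> i < j \<and> j \<le> 5} \<union> Ly ` {1..5}"

lemma spinor_labels_eq:
  "spinor_labels = {Lx0,
     Lx 1 2, Lx 1 3, Lx 1 4, Lx 1 5, Lx 2 3, Lx 2 4, Lx 2 5, Lx 3 4, Lx 3 5, Lx 4 5,
     Ly 1, Ly 2, Ly 3, Ly 4, Ly 5}"
proof -
  have "spinor_labels = {l \<in> labels. case l of La i \<Rightarrow> False | Lb i \<Rightarrow> False | Lw \<Rightarrow> False | _ \<Rightarrow> True}"
  proof (intro set_eqI)
    fix l show "l \<in> spinor_labels \<longleftrightarrow>
        l \<in> {l \<in> labels. case l of La i \<Rightarrow> False | Lb i \<Rightarrow> False | Lw \<Rightarrow> False | _ \<Rightarrow> True}"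
      by (cases l) (auto simp: spinor_labels_def)
  qed
  also have "\<dots> = {Lx0,
     Lx 1 2, Lx 1 3, Lx 1 4, Lx 1 5, Lx 2 3, Lx 2 4, Lx 2 5, Lx 3 4, Lx 3 5, Lx 4 5,
     Ly 1, Ly 2, Ly 3, Ly 4, Ly 5}"
    unfolding labels_eq by auto
  finally show ?thesis .
qed

lemma labels_decomp:
  "labels = spinor_labels \<union> La ` {1..5} \<union> Lb ` {1..5} \<union> {Lw}"
  by (auto simp: labels_def spinor_labels_def)

lemma var_vec_of [simp]: "l \<in> labels \<Longrightarrow> var l (vec_of g) = g l"
  by (simp add: var_def vec_of_def Abs_coord_inverse)

lemma var_linear [simp]:
  "var l (u + v) = var l u + var l v" "var l (u - v) = var l u - var l v"
  "var l (c *s v) = c * var l v" "var l 0 = 0" "var l (- v) = - var l v"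
  by (simp_all add: var_def)

lemma var_unit [simp]:
  "l \<in> labels \<Longrightarrow> l' \<in> labels \<Longrightarrow> var l (unit l') = (if l = l' then 1 else 0)"
  by (simp add: var_def axis_def Abs_coord_inject)

lemma cvec_eqI: "(\<And>l. l \<in> labels \<Longrightarrow> var l u = var l v) \<Longrightarrow> u = v"
  by (metis var_def vec_eq_iff Rep_coord Rep_coord_inverse)

lemma all_coord: "(\<forall>k. Q k) \<longleftrightarrow> (\<forall>l\<in>labels. Q (Abs_coord l))"
  by (metis Rep_coord Rep_coord_inverse)

lemma P_entry_linear [simp]:
  "P_entry (u + v) i j = P_entry u i j + P_entry v i j"
  "P_entry (c *s v) i j = c * P_entry v i j"
  by (simp_all add: P_entry_def)

lemma sum_5:
  "(\<Sum>i = 1..5. g i) = g 1 + g 2 + g 3 + g 4 + g (5::nat)"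
  "(\<Sum>i = Suc 0..5. g i) = g 1 + g 2 + g 3 + g 4 + g (5::nat)"
  by (simp_all add: numeral_eq_Suc)

section \<open>Chevalley generators on the coordinate space\<close>

text \<open>
  The variables \<open>a\<close> form the standard representation \<open>U\<close> of \<open>sl(5)\<close>, the variables \<open>y\<close> and \<open>b\<close> its
  dual, the matrix \<open>P\<close> its exterior square, and \<open>x0\<close>, \<open>w\<close> are trivial.  The value is the coordinate with
  label \<open>l\<close> of the image of \<open>v\<close> under the elementary matrix \<open>E\<close> with its single 1 in place \<open>(p, r)\<close>:
  it acts by \<open>E P + P E\<^sup>T\<close> on \<open>P\<close> and by \<open>- E\<^sup>T\<close> on the dual.  All operators below are given
  by their coordinates in this way, so that products of several of them can be evaluated one label at a
  time.
\<close>

definition sl5_elem :: "nat \<Rightarrow> nat \<Rightarrow> cvec \<Rightarrow> label \<Rightarrow> complex" where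
  "sl5_elem p r v l = (case l of
       Lx i j \<Rightarrow> (if i = p then P_entry v r j else 0) + (if j = p then P_entry v i r else 0)
     | Ly i \<Rightarrow> if i = r then - var (Ly p) v else 0
     | La i \<Rightarrow> if i = p then var (La r) v else 0
     | Lb i \<Rightarrow> if i = r then - var (Lb p) v else 0
     | _ \<Rightarrow> 0)"

text \<open>
  The nodes 2, 4, 5, 6 form a chain of type A4, hence an \<open>sl(5)\<close>; this is the position of a node in that
  chain.
\<close>

definition slot :: "nat \<Rightarrow> nat" where
  "slot i = (if i = 2 then 1 else i - 2)"

text \<open>
  Node 3 extends the \<open>sl(5)\<close> to \<open>so(10)\<close>, for which \<open>x0, P, y\<close> form a half-spin representation
  and \<open>a, b\<close> the vector representation.  Node 1 joins the invariant coordinate \<open>w\<close> to the spinors and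
  the spinors to the vectors.  The signs are forced by invariance of the cubic form: when node 3 changes
  \<open>x12\<close> by \<open>x0\<close>, the forms \<open>q 3, q 4, q 5\<close> are preserved only if \<open>y3, y4, y5\<close> change by
  \<open>- x45, x35, - x34\<close>; then \<open>q' 1, q' 2\<close> change by \<open>- q 2, q 1\<close>, which the change of
  \<open>a1, a2\<close> has to compensate.
\<close>

definition lower :: "nat \<Rightarrow> cvec \<Rightarrow> label \<Rightarrow> complex" where
  "lower i v l =
     (if i = 1 then (case l of
          Lx0 \<Rightarrow> var Lw v
        | Lb j \<Rightarrow> var (Ly j) v
        | _ \<Rightarrow> 0)
      else if i = 3 then (case l of
          Lx j k \<Rightarrow> if j = 1 \<and> k = 2 then var Lx0 v else 0
        | Ly j \<Rightarrow> if j = 3 then - var (Lx 4 5) v else if j = 4 then var (Lx 3 5) v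
                 else if j = 5 then - var (Lx 3 4) v else 0
        | La j \<Rightarrow> if j = 1 then - var (Lb 2) v else if j = 2 then var (Lb 1) v else 0
        | _ \<Rightarrow> 0)
      else sl5_elem (slot i + 1) (slot i) v l)"

text \<open>The transposes of the lowering operators.\<close>

definition raise :: "nat \<Rightarrow> cvec \<Rightarrow> label \<Rightarrow> complex" where
  "raise i v l =
     (if i = 1 then (case l of
          Lw \<Rightarrow> var Lx0 v
        | Ly j \<Rightarrow> var (Lb j) v
        | _ \<Rightarrow> 0)
      else if i = 3 then (case l of
          Lx0 \<Rightarrow> var (Lx 1 2) v
        | Lx j k \<Rightarrow> if j = 4 \<and> k = 5 then - var (Ly 3) v
                   else if j = 3 \<and> k = 5 then var (Ly 4) v
                   else if j = 3 \<and> k = 4 then - var (Ly 5) v else 0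
        | Lb j \<Rightarrow> if j = 2 then - var (La 1) v else if j = 1 then var (La 2) v else 0
        | _ \<Rightarrow> 0)
      else sl5_elem (slot i) (slot i + 1) v l)"

text \<open>
  The weight of a coordinate: its eigenvalue under the coroot of a node.  All these integers lie in
  \<open>{-1, 0, 1}\<close>, as the representation is minuscule.
\<close>

definition wt :: "nat \<Rightarrow> label \<Rightarrow> int" where
  "wt i l =
     (if i = 1 then (case l of Lw \<Rightarrow> 1 | Lx0 \<Rightarrow> - 1 | Ly j \<Rightarrow> 1 | Lb j \<Rightarrow> - 1 | _ \<Rightarrow> 0)
      else if i = 3 then (case l of
          Lx0 \<Rightarrow> 1
        | Lx j k \<Rightarrow> if k \<le> 2 then - 1 else if 3 \<le> j then 1 else 0
        | Ly j \<Rightarrow> if 3 \<le> j then - 1 else 0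
        | La j \<Rightarrow> if j \<le> 2 then - 1 else 0
        | Lb j \<Rightarrow> if j \<le> 2 then 1 else 0
        | Lw \<Rightarrow> 0)
      else let d = (\<lambda>j. if j = slot i then 1 else if j = slot i + 1 then - 1 else 0)
           in (case l of Lx j k \<Rightarrow> d j + d k | Ly j \<Rightarrow> - d j | La j \<Rightarrow> d j | Lb j \<Rightarrow> - d j | _ \<Rightarrow> 0))"

definition e6 :: "nat \<Rightarrow> cmat" where "e6 i = matrix (\<lambda>v. vec_of (raise i v))"
definition f6 :: "nat \<Rightarrow> cmat" where "f6 i = matrix (\<lambda>v. vec_of (lower i v))"
definition diag :: "(coord \<Rightarrow> complex) \<Rightarrow> cmat" where
  "diag d = (\<chi> k l. if k = l then d k else 0)"
definition h6 :: "nat \<Rightarrow> cmat" where "h6 i = diag (\<lambda>k. of_int (wt i (Rep_coord k)))"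

lemma diag_apply [simp]: "(diag d *v v) $ k = d k * v $ k"
  by (simp add: diag_def matrix_vector_mult_def if_distrib[where f="\<lambda>x. x * _"] cong: if_cong)

lemma var_h6 [simp]: "l \<in> labels \<Longrightarrow> var l (h6 i *v v) = of_int (wt i l) * var l v"
  by (simp add: var_def h6_def Abs_coord_inverse)

lemma linearI_labels:
  assumes "\<And>l u v. l \<in> labels \<Longrightarrow> var l (T (u + v)) = var l (T u) + var l (T v)"
    and "\<And>l c v. l \<in> labels \<Longrightarrow> var l (T (c *s v)) = c * var l (T v)"
  shows "Vector_Spaces.linear (*s) (*s) (T :: cvec \<Rightarrow> cvec)"
  by (intro Vector_Spaces.linear_iff[THEN iffD2] conjI allI cvec_eqI)
     (simp_all add: assms vec.vector_space_axioms)

lemma matrix_labels: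
  fixes T :: "cvec \<Rightarrow> cvec"
  assumes "\<And>l u v. l \<in> labels \<Longrightarrow> var l (T (u + v)) = var l (T u) + var l (T v)"
    and "\<And>l c v. l \<in> labels \<Longrightarrow> var l (T (c *s v)) = c * var l (T v)"
  shows "matrix T *v v = (T v :: cvec)"
  using matrix_works[OF linearI_labels[of T, OF assms]] by blast

lemma e6_apply: "e6 i *v v = vec_of (raise i v)"
  unfolding e6_def
  apply (rule matrix_labels)
  subgoal for l u v
    by (cases l) (simp_all add: raise_def sl5_elem_def distrib_left)
  subgoal for l c v
    by (cases l) (simp_all add: raise_def sl5_elem_def distrib_left)
  done

lemma var_e6 [simp]: "l \<in> labels \<Longrightarrow> var l (e6 i *v v) = raise i v l"
  by (simp add: e6_apply)

lemma f6_apply: "f6 i *v v = vec_of (lower i v)"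
  unfolding f6_def
  apply (rule matrix_labels)
  subgoal for l u v
    by (cases l) (simp_all add: lower_def sl5_elem_def distrib_left)
  subgoal for l c v
    by (cases l) (simp_all add: lower_def sl5_elem_def distrib_left)
  done

lemma var_f6 [simp]: "l \<in> labels \<Longrightarrow> var l (f6 i *v v) = lower i v l"
  by (simp add: f6_apply)

lemma bracket_apply: "bracket M N *v v = M *v (N *v v) - N *v (M *v v)"
  by (simp add: bracket_def matrix_vector_mult_diff_rdistrib matrix_vector_mul_assoc)

lemma mat_apply [simp]: "(mat c ** M) *v v = c *s (M *v (v::cvec))"
  by (simp add: vec_eq_iff matrix_vector_mult_def matrix_matrix_mult_def mat_def sum_distrib_left
       sum.delta if_distrib[where f="\<lambda>x. x * _"] mult.assoc cong: if_cong)

lemma matrix_eqI_labels: "(\<And>v l. l \<in> labels \<Longrightarrow> var l (M *v v) = var l (N *v v)) \<Longrightarrow> (M::cmat) = N"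
  by (metis cvec_eqI matrix_eq)

section \<open>The Serre relations\<close>

lemma forall_nodes: "(\<forall>i\<in>{1..6::nat}. Q i) \<longleftrightarrow> Q 1 \<and> Q 2 \<and> Q 3 \<and> Q 4 \<and> Q 5 \<and> Q 6"
proof -
  have "{1..6::nat} = {1,2,3,4,5,6}" by auto
  then show ?thesis by simp
qed

lemma matrix_eq_labels:
  "(M::cmat) = N \<longleftrightarrow> (\<forall>v. \<forall>l\<in>labels. var l (M *v v) = var l (N *v v))"
  by (metis matrix_eqI_labels)

lemma var_two_times: "var l (2 * v) = 2 * var l v"
  by (simp add: var_def)

text \<open>Arithmetic on indices may end in a successor term, which has to match the numeral in a label.\<close>

lemma two_Suc: "Suc (Suc 0) = 2"
  by simp

lemma funpow_two: "(g ^^ 2) x = g (g x)"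
  by (simp add: numeral_2_eq_2)

text \<open>
  Each of the relations is an identity between sparse matrices; it is verified by applying both sides to a
  general vector and comparing the 27 coordinates.
\<close>

lemmas matrix_evaluation =
  var_two_times two_Suc funpow_two
  matrix_eq_labels labels_eq bracket_apply matrix_vector_mult_diff_distrib
  raise_def lower_def sl5_elem_def slot_def wt_def P_entry_def

lemma bracket_h_h: "bracket (h6 i) (h6 j) = 0"
  by (simp add: matrix_eq_labels bracket_apply)

lemma bracket_e_f_same: "\<forall>i\<in>{1..6}. bracket (e6 i) (f6 i) = h6 i"
  unfolding forall_nodes
  by (intro conjI; simp add: matrix_evaluation)

lemma bracket_e_f: "\<forall>i\<in>{1..6}. \<forall>j\<in>{1..6}. i \<noteq> j \<longrightarrow> bracket (e6 i) (f6 j) = 0"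
  unfolding forall_nodes
  by (intro conjI; simp add: matrix_evaluation)

lemma bracket_h_e: "\<forall>i\<in>{1..6}. \<forall>j\<in>{1..6}.
    bracket (h6 i) (e6 j) = mat (of_int (E6_cartan i j)) ** e6 j"
  unfolding forall_nodes
  by (intro conjI; simp add: matrix_evaluation E6_cartan_def doubleton_eq_iff)

lemma bracket_h_f: "\<forall>i\<in>{1..6}. \<forall>j\<in>{1..6}.
    bracket (h6 i) (f6 j) = mat (of_int (- E6_cartan i j)) ** f6 j"
  unfolding forall_nodes
  by (intro conjI; simp add: matrix_evaluation E6_cartan_def doubleton_eq_iff)

lemma serre_e: "\<forall>i\<in>{1..6}. \<forall>j\<in>{1..6}. i \<noteq> j \<longrightarrow>
    (bracket (e6 i) ^^ nat (1 - E6_cartan i j)) (e6 j) = 0"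
  unfolding forall_nodes
  by (intro conjI; simp add: matrix_evaluation E6_cartan_def doubleton_eq_iff)

lemma serre_f: "\<forall>i\<in>{1..6}. \<forall>j\<in>{1..6}. i \<noteq> j \<longrightarrow>
    (bracket (f6 i) ^^ nat (1 - E6_cartan i j)) (f6 j) = 0"
  unfolding forall_nodes
  by (intro conjI; simp add: matrix_evaluation E6_cartan_def doubleton_eq_iff)

section \<open>Irreducibility\<close>

text \<open>
  Subtracting \<open>d j\<close> from the diagonal operator kills coordinate \<open>j\<close> and rescales the others
  by nonzero factors, so all coordinates except the \<open>k\<close>-th can be removed in turn.
\<close>

lemma diagonal_separates:
  assumes U: "vec.subspace U" and d: "inj d" and closed: "\<And>v. v \<in> U \<Longrightarrow> diag d *v v \<in> U"
    and u: "u \<in> U" "u $ k \<noteq> 0"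
  shows "axis k 1 \<in> U"
proof -
  have "\<exists>v\<in>U. v $ k \<noteq> 0 \<and> (\<forall>j\<in>S. v $ j = 0)" if "finite S" "k \<notin> S" for S
    using that
  proof induct
    case empty
    then show ?case using u by auto
  next
    case (insert j S)
    then obtain v where v: "v \<in> U" "v $ k \<noteq> 0" "\<forall>i\<in>S. v $ i = 0" by auto
    let ?v = "diag d *v v - d j *s v"
    have "?v \<in> U" using U v(1) closed by (simp add: vec.subspace_diff vec.subspace_scale)
    moreover have "d k \<noteq> d j" using insert d by (auto simp: inj_eq)
    then have "?v $ k \<noteq> 0" using v(2) by simp
    moreover have "\<forall>i\<in>insert j S. ?v $ i = 0" using v(3) by simp
    ultimately show ?case by blast
  qed
  from this[of "- {k}"] obtain v where v: "v \<in> U" "v $ k \<noteq> 0" "\<forall>j\<in>- {k}. v $ j = 0" by auto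
  then have "(1 / v $ k) *s v = axis k 1" by (auto simp: vec_eq_iff axis_def)
  then show ?thesis using U v(1) by (metis vec.subspace_scale)
qed

lemma cvec_eq_labels: "u = v \<longleftrightarrow> (\<forall>l\<in>labels. var l u = var l v)"
  by (metis cvec_eqI)

text \<open>
  The edges of the weight diagram that are used to connect all weights; the spinors need only the nodes of
  \<open>so(10)\<close>.
\<close>

lemma lowering_spinors:
  "f6 3 *v unit Lx0 = unit (Lx 1 2)"
  "f6 4 *v unit (Lx 1 2) = unit (Lx 1 3)" "f6 5 *v unit (Lx 1 3) = unit (Lx 1 4)"
  "f6 6 *v unit (Lx 1 4) = unit (Lx 1 5)" "f6 2 *v unit (Lx 1 3) = unit (Lx 2 3)"
  "f6 5 *v unit (Lx 2 3) = unit (Lx 2 4)" "f6 6 *v unit (Lx 2 4) = unit (Lx 2 5)"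
  "f6 4 *v unit (Lx 2 4) = unit (Lx 3 4)" "f6 4 *v unit (Lx 2 5) = unit (Lx 3 5)"
  "f6 5 *v unit (Lx 3 5) = unit (Lx 4 5)"
  "f6 3 *v unit (Lx 3 4) = - unit (Ly 5)" "f6 3 *v unit (Lx 3 5) = unit (Ly 4)"
  "f6 3 *v unit (Lx 4 5) = - unit (Ly 3)"
  "f6 4 *v unit (Ly 3) = - unit (Ly 2)" "f6 2 *v unit (Ly 2) = - unit (Ly 1)"
  by (simp_all add: cvec_eq_labels labels_eq two_Suc lower_def sl5_elem_def slot_def P_entry_def)

lemma lowering_rest:
  "f6 1 *v unit Lw = unit Lx0"
  "f6 1 *v unit (Ly 1) = unit (Lb 1)" "f6 1 *v unit (Ly 2) = unit (Lb 2)"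
  "f6 1 *v unit (Ly 3) = unit (Lb 3)" "f6 1 *v unit (Ly 4) = unit (Lb 4)"
  "f6 1 *v unit (Ly 5) = unit (Lb 5)"
  "f6 3 *v unit (Lb 2) = - unit (La 1)" "f6 3 *v unit (Lb 1) = unit (La 2)"
  "f6 4 *v unit (La 2) = unit (La 3)" "f6 5 *v unit (La 3) = unit (La 4)"
  "f6 6 *v unit (La 4) = unit (La 5)"
  by (simp_all add: cvec_eq_labels labels_eq two_Suc lower_def sl5_elem_def slot_def P_entry_def)

lemma raising:
  "e6 1 *v unit Lx0 = unit Lw" "e6 3 *v unit (Lx 1 2) = unit Lx0"
  "e6 4 *v unit (Lx 1 3) = unit (Lx 1 2)" "e6 5 *v unit (Lx 1 4) = unit (Lx 1 3)"
  "e6 6 *v unit (Lx 1 5) = unit (Lx 1 4)" "e6 2 *v unit (Lx 2 3) = unit (Lx 1 3)"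
  "e6 5 *v unit (Lx 2 4) = unit (Lx 2 3)" "e6 6 *v unit (Lx 2 5) = unit (Lx 2 4)"
  "e6 4 *v unit (Lx 3 4) = unit (Lx 2 4)" "e6 4 *v unit (Lx 3 5) = unit (Lx 2 5)"
  "e6 5 *v unit (Lx 4 5) = unit (Lx 3 5)"
  "e6 3 *v unit (Ly 5) = - unit (Lx 3 4)" "e6 3 *v unit (Ly 4) = unit (Lx 3 5)"
  "e6 3 *v unit (Ly 3) = - unit (Lx 4 5)"
  "e6 4 *v unit (Ly 2) = - unit (Ly 3)" "e6 2 *v unit (Ly 1) = - unit (Ly 2)"
  "e6 1 *v unit (Lb 1) = unit (Ly 1)" "e6 1 *v unit (Lb 2) = unit (Ly 2)"
  "e6 1 *v unit (Lb 3) = unit (Ly 3)" "e6 1 *v unit (Lb 4) = unit (Ly 4)"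
  "e6 1 *v unit (Lb 5) = unit (Ly 5)"
  "e6 3 *v unit (La 1) = - unit (Lb 2)" "e6 3 *v unit (La 2) = unit (Lb 1)"
  "e6 4 *v unit (La 3) = unit (La 2)" "e6 5 *v unit (La 4) = unit (La 3)"
  "e6 6 *v unit (La 5) = unit (La 4)"
  by (simp_all add: cvec_eq_labels labels_eq two_Suc raise_def sl5_elem_def slot_def P_entry_def)

lemma subspace_uminus_iff: "vec.subspace U \<Longrightarrow> - v \<in> U \<longleftrightarrow> v \<in> (U :: cvec set)"
  by (metis minus_minus vec.subspace_neg)

text \<open>
  Besides irreducibility this also serves for the set of spinors \<open>s\<close> whose operator
  \<open>nilradical s\<close> lies in the Lie algebra; there, equivariance under \<open>so(10)\<close> gives closure under
  the nodes 2 to 6.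
\<close>

lemma spinors_from_x0:
  assumes U: "vec.subspace U" and closed: "\<And>i v. i \<in> {2..6} \<Longrightarrow> v \<in> U \<Longrightarrow> f6 i *v v \<in> U"
    and x0: "unit Lx0 \<in> U"
  shows "\<forall>l\<in>spinor_labels. unit l \<in> U"
proof -
  have "f6 i *v v \<in> U" if "v \<in> U" "i = 2 \<or> i = 3 \<or> i = 4 \<or> i = 5 \<or> i = 6" for i v
    using closed[OF _ that(1), of i] that(2) by auto
  note step = this[where i = 2, simplified] this[where i = 3, simplified]
    this[where i = 4, simplified] this[where i = 5, simplified] this[where i = 6, simplified]
  have x: "unit (Lx 1 2) \<in> U" using step(2)[OF x0] by (simp only: lowering_spinors)
  have x13: "unit (Lx 1 3) \<in> U" using step(3)[OF x] by (simp only: lowering_spinors)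
  have x14: "unit (Lx 1 4) \<in> U" using step(4)[OF x13] by (simp only: lowering_spinors)
  have x15: "unit (Lx 1 5) \<in> U" using step(5)[OF x14] by (simp only: lowering_spinors)
  have x23: "unit (Lx 2 3) \<in> U" using step(1)[OF x13] by (simp only: lowering_spinors)
  have x24: "unit (Lx 2 4) \<in> U" using step(4)[OF x23] by (simp only: lowering_spinors)
  have x25: "unit (Lx 2 5) \<in> U" using step(5)[OF x24] by (simp only: lowering_spinors)
  have x34: "unit (Lx 3 4) \<in> U" using step(3)[OF x24] by (simp only: lowering_spinors)
  have x35: "unit (Lx 3 5) \<in> U" using step(3)[OF x25] by (simp only: lowering_spinors)
  have x45: "unit (Lx 4 5) \<in> U" using step(4)[OF x35] by (simp only: lowering_spinors)
  have y5: "unit (Ly 5) \<in> U" using step(2)[OF x34] by (simp only: lowering_spinors subspace_uminus_iff[OF U])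
  have y4: "unit (Ly 4) \<in> U" using step(2)[OF x35] by (simp only: lowering_spinors)
  have y3: "unit (Ly 3) \<in> U" using step(2)[OF x45] by (simp only: lowering_spinors subspace_uminus_iff[OF U])
  have y2: "unit (Ly 2) \<in> U" using step(3)[OF y3] by (simp only: lowering_spinors subspace_uminus_iff[OF U])
  have y1: "unit (Ly 1) \<in> U" using step(1)[OF y2] by (simp only: lowering_spinors subspace_uminus_iff[OF U])
  show ?thesis
    unfolding spinor_labels_eq using x0 x x13 x14 x15 x23 x24 x25 x34 x35 x45 y1 y2 y3 y4 y5 by blast
qed

lemma all_from_w:
  assumes U: "vec.subspace U" and closed: "\<And>i v. i \<in> {1..6} \<Longrightarrow> v \<in> U \<Longrightarrow> f6 i *v v \<in> U"
    and w: "unit Lw \<in> U"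
  shows "U = UNIV"
proof -
  have c: "f6 1 *v v \<in> U" "f6 3 *v v \<in> U" "f6 4 *v v \<in> U" "f6 5 *v v \<in> U" "f6 6 *v v \<in> U"
    if "v \<in> U" for v using closed that by auto
  have "unit Lx0 \<in> U" using c(1)[OF w] by (simp only: lowering_rest)
  then have s: "\<forall>l\<in>spinor_labels. unit l \<in> U"
    using spinors_from_x0[OF U] closed by auto
  then have "unit (Ly 1) \<in> U" "unit (Ly 2) \<in> U" "unit (Ly 3) \<in> U" "unit (Ly 4) \<in> U" "unit (Ly 5) \<in> U"
    unfolding spinor_labels_eq by blast+
  then have b: "unit (Lb 1) \<in> U" "unit (Lb 2) \<in> U" "unit (Lb 3) \<in> U" "unit (Lb 4) \<in> U" "unit (Lb 5) \<in> U"
    using c(1) by (metis lowering_rest)+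
  have a1: "unit (La 1) \<in> U" using c(2)[OF b(2)] by (simp only: lowering_rest subspace_uminus_iff[OF U])
  have a2: "unit (La 2) \<in> U" using c(2)[OF b(1)] by (simp only: lowering_rest)
  have a3: "unit (La 3) \<in> U" using c(3)[OF a2] by (simp only: lowering_rest)
  have a4: "unit (La 4) \<in> U" using c(4)[OF a3] by (simp only: lowering_rest)
  have a5: "unit (La 5) \<in> U" using c(5)[OF a4] by (simp only: lowering_rest)
  have "\<forall>l\<in>labels. unit l \<in> U"
    using w s a1 a2 a3 a4 a5 b unfolding labels_eq spinor_labels_eq by blast
  then have "\<forall>k. axis k 1 \<in> U" unfolding all_coord .
  then have "(\<Sum>k\<in>UNIV. v $ k *s axis k 1) \<in> U" for v :: cvec
    by (intro vec.subspace_sum vec.subspace_scale U) blast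
  then show ?thesis by (auto simp: basis_expansion)
qed

lemma climb_to_w:
  assumes U: "vec.subspace U" and closed: "\<And>i v. i \<in> {1..6} \<Longrightarrow> v \<in> U \<Longrightarrow> e6 i *v v \<in> U"
    and l: "l \<in> labels" "unit l \<in> U"
  shows "unit Lw \<in> U"
proof -
  have c: "e6 1 *v v \<in> U" "e6 2 *v v \<in> U" "e6 3 *v v \<in> U" "e6 4 *v v \<in> U" "e6 5 *v v \<in> U"
    "e6 6 *v v \<in> U" if "v \<in> U" for v using closed that by auto
  note neg = subspace_uminus_iff[OF U]
  have x0: "unit Lx0 \<in> U \<Longrightarrow> ?thesis" using c(1) raising by metis
  have x12: "unit (Lx 1 2) \<in> U \<Longrightarrow> ?thesis" using c(3) raising x0 by metis
  have x13: "unit (Lx 1 3) \<in> U \<Longrightarrow> ?thesis" using c(4) raising x12 by metis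
  have x14: "unit (Lx 1 4) \<in> U \<Longrightarrow> ?thesis" using c(5) raising x13 by metis
  have x15: "unit (Lx 1 5) \<in> U \<Longrightarrow> ?thesis" using c(6) raising x14 by metis
  have x23: "unit (Lx 2 3) \<in> U \<Longrightarrow> ?thesis" using c(2) raising x13 by metis
  have x24: "unit (Lx 2 4) \<in> U \<Longrightarrow> ?thesis" using c(5) raising x23 by metis
  have x25: "unit (Lx 2 5) \<in> U \<Longrightarrow> ?thesis" using c(6) raising x24 by metis
  have x34: "unit (Lx 3 4) \<in> U \<Longrightarrow> ?thesis" using c(4) raising x24 by metis
  have x35: "unit (Lx 3 5) \<in> U \<Longrightarrow> ?thesis" using c(4) raising x25 by metis
  have x45: "unit (Lx 4 5) \<in> U \<Longrightarrow> ?thesis" using c(5) raising x35 by metis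
  have y5: "unit (Ly 5) \<in> U \<Longrightarrow> ?thesis" using c(3) raising x34 neg by metis
  have y4: "unit (Ly 4) \<in> U \<Longrightarrow> ?thesis" using c(3) raising x35 by metis
  have y3: "unit (Ly 3) \<in> U \<Longrightarrow> ?thesis" using c(3) raising x45 neg by metis
  have y2: "unit (Ly 2) \<in> U \<Longrightarrow> ?thesis" using c(4) raising y3 neg by metis
  have y1: "unit (Ly 1) \<in> U \<Longrightarrow> ?thesis" using c(2) raising y2 neg by metis
  have b1: "unit (Lb 1) \<in> U \<Longrightarrow> ?thesis" using c(1) raising y1 by metis
  have b2: "unit (Lb 2) \<in> U \<Longrightarrow> ?thesis" using c(1) raising y2 by metis
  have b3: "unit (Lb 3) \<in> U \<Longrightarrow> ?thesis" using c(1) raising y3 by metis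
  have b4: "unit (Lb 4) \<in> U \<Longrightarrow> ?thesis" using c(1) raising y4 by metis
  have b5: "unit (Lb 5) \<in> U \<Longrightarrow> ?thesis" using c(1) raising y5 by metis
  have a1: "unit (La 1) \<in> U \<Longrightarrow> ?thesis" using c(3) raising b2 neg by metis
  have a2: "unit (La 2) \<in> U \<Longrightarrow> ?thesis" using c(3) raising b1 by metis
  have a3: "unit (La 3) \<in> U \<Longrightarrow> ?thesis" using c(4) raising a2 by metis
  have a4: "unit (La 4) \<in> U \<Longrightarrow> ?thesis" using c(5) raising a3 by metis
  have a5: "unit (La 5) \<in> U \<Longrightarrow> ?thesis" using c(6) raising a4 by metis
  show ?thesis
    using l unfolding labels_eq
    by (elim insertE emptyE) (use x0 x12 x13 x14 x15 x23 x24 x25 x34 x35 x45 y1 y2 y3 y4 y5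
      a1 a2 a3 a4 a5 b1 b2 b3 b4 b5 in \<open>simp_all only: \<close>)
qed

text \<open>
  A generic element of the Cartan subalgebra.  The weights are six digits in \<open>{-1, 0, 1}\<close>, and they are
  combined as a number in balanced ternary notation, so that different weights give different numbers.
\<close>

definition gen_wt :: "label \<Rightarrow> int" where
  "gen_wt l = wt 1 l + 3 * wt 2 l + 9 * wt 3 l + 27 * wt 4 l + 81 * wt 5 l + 243 * wt 6 l"

definition gen_h :: cmat where
  "gen_h = diag (\<lambda>k. of_int (gen_wt (Rep_coord k)))"

lemma inj_gen_wt: "inj_on gen_wt labels"
proof (rule eq_card_imp_inj_on)
  show "finite labels" by (simp add: labels_eq)
  have "gen_wt ` labels =
     {8, 1, 18, 57, 165, - 240, 78, 186, - 219, 225, - 180, - 72, - 2,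
      - 23, - 62, - 170, 235, - 6, 15, 54, 162, - 243, 5, - 16, - 55, - 163, 242}"
    unfolding labels_eq image_insert image_empty
    by (simp add: gen_wt_def wt_def slot_def)
  then show "card (gen_wt ` labels) = card labels" by (simp add: card_labels)
qed

lemma inj_gen_h: "inj (\<lambda>k. of_int (gen_wt (Rep_coord k)) :: complex)"
  by (rule injI) (metis Rep_coord Rep_coord_inject inj_gen_wt inj_onD of_int_eq_iff)

lemma gen_h_eq: "gen_h = h6 1 + mat 3 ** h6 2 + mat 9 ** h6 3 + mat 27 ** h6 4 + mat 81 ** h6 5
    + mat 243 ** h6 6"
  by (rule matrix_eqI_labels)
     (simp add: gen_h_def gen_wt_def var_def h6_def Abs_coord_inverse algebra_simps matrix_vector_mult_add_rdistrib)

text \<open>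
  The generic diagonal operator extracts a coordinate vector from any nonzero vector; the raising operators
  lead from it to the highest weight vector \<open>w\<close>, and the lowering operators from there to every
  coordinate vector.
\<close>

lemma rep_irreducible:
  assumes U: "vec.subspace U"
    and closed: "\<forall>i\<in>{1..6}. \<forall>v\<in>U. e6 i *v v \<in> U \<and> f6 i *v v \<in> U \<and> h6 i *v v \<in> U"
  shows "U = {0} \<or> U = UNIV"
proof (cases "U = {0}")
  case False
  then obtain u where u: "u \<in> U" "u \<noteq> 0" using vec.subspace_0[OF U] by blast
  then obtain k where k: "u $ k \<noteq> 0" by (metis vec_eq_iff zero_index)
  have "gen_h *v v \<in> U" if "v \<in> U" for v
    unfolding gen_h_eq matrix_vector_mult_add_rdistrib mat_apply
    using closed that by (intro vec.subspace_add[OF U] vec.subspace_scale[OF U]) auto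
  then have "axis k 1 \<in> U"
    using diagonal_separates[OF U inj_gen_h _ u(1) k] by (simp add: gen_h_def)
  then have "unit (Rep_coord k) \<in> U" by (simp add: Rep_coord_inverse)
  then have "unit Lw \<in> U"
    using climb_to_w[OF U _ Rep_coord] closed by blast
  then show ?thesis using all_from_w[OF U] closed by blast
qed simp

section \<open>The polarised cubic form\<close>

definition Pf_polar :: "nat \<Rightarrow> cvec \<Rightarrow> cvec \<Rightarrow> complex" where
  "Pf_polar i u v =
     (let M = (\<lambda>k l. P_entry u (skip i k) (skip i l)); N = (\<lambda>k l. P_entry v (skip i k) (skip i l))
      in M 1 2 * N 3 4 + N 1 2 * M 3 4 - (M 1 3 * N 2 4 + N 1 3 * M 2 4) + (M 1 4 * N 2 3 + N 1 4 * M 2 3))"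

definition q_polar :: "nat \<Rightarrow> cvec \<Rightarrow> cvec \<Rightarrow> complex" where
  "q_polar i u v = var Lx0 u * var (Ly i) v + var Lx0 v * var (Ly i) u + (-1) ^ (i - 1) * Pf_polar i u v"

definition q'_polar :: "nat \<Rightarrow> cvec \<Rightarrow> cvec \<Rightarrow> complex" where
  "q'_polar i u v = (\<Sum>j = 1..5. var (Ly j) u * P_entry v j i + var (Ly j) v * P_entry u j i)"

text \<open>
  The form \<open>F_C\<close> is quadratic in the spinor, linear in the vector, plus a term quadratic in the vector and
  linear in \<open>w\<close>.  Here \<open>z\<close> takes the linear slot.
\<close>

definition cubic_part :: "cvec \<Rightarrow> cvec \<Rightarrow> cvec \<Rightarrow> complex" where
  "cubic_part u v z = (\<Sum>i = 1..5. q_polar i u v * var (La i) z + q'_polar i u v * var (Lb i) z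
     - (var (La i) u * var (Lb i) v + var (La i) v * var (Lb i) u) * var Lw z)"

definition cubic_polar :: "cvec \<Rightarrow> cvec \<Rightarrow> cvec \<Rightarrow> complex" where
  "cubic_polar u v z = cubic_part u v z + cubic_part v z u + cubic_part z u v"

lemma Pf_polar_commute: "Pf_polar i u v = Pf_polar i v u"
  by (simp add: Pf_polar_def Let_def algebra_simps)

lemma q_polar_commute: "q_polar i u v = q_polar i v u"
  by (simp add: q_polar_def Pf_polar_commute[of i u v])

lemma q'_polar_commute: "q'_polar i u v = q'_polar i v u"
  by (simp add: q'_polar_def add.commute)

lemma cubic_part_commute: "cubic_part u v z = cubic_part v u z"
  by (simp add: cubic_part_def q_polar_commute[of _ u v] q'_polar_commute[of _ u v] add.commute)

lemma cubic_polar_rotate: "cubic_polar u v z = cubic_polar v z u"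
  by (simp add: cubic_polar_def add.commute add.left_commute)

lemma cubic_polar_commute: "cubic_polar u v z = cubic_polar v u z"
  by (simp add: cubic_polar_def cubic_part_commute[of u v] cubic_part_commute[of u z]
      cubic_part_commute[of z v])

lemma Pf_polar_linear:
  "Pf_polar i (u + u') v = Pf_polar i u v + Pf_polar i u' v"
  "Pf_polar i (c *s u) v = c * Pf_polar i u v"
  by (simp_all add: Pf_polar_def Let_def algebra_simps)

lemma q_polar_linear:
  "q_polar i (u + u') v = q_polar i u v + q_polar i u' v"
  "q_polar i (c *s u) v = c * q_polar i u v"
  by (simp_all add: q_polar_def Pf_polar_linear algebra_simps)

lemma q'_polar_linear:
  "q'_polar i (u + u') v = q'_polar i u v + q'_polar i u' v"
  "q'_polar i (c *s u) v = c * q'_polar i u v"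
  by (simp_all add: q'_polar_def sum.distrib sum_distrib_left algebra_simps)

lemma cubic_part_linear:
  "cubic_part (u + u') v z = cubic_part u v z + cubic_part u' v z"
  "cubic_part (c *s u) v z = c * cubic_part u v z"
  "cubic_part v z (u + u') = cubic_part v z u + cubic_part v z u'"
  "cubic_part v z (c *s u) = c * cubic_part v z u"
  by (simp_all add: cubic_part_def q_polar_linear q'_polar_linear sum.distrib sum_distrib_left
        sum_subtractf algebra_simps)

lemma cubic_polar_linear1:
  "cubic_polar (u + u') v z = cubic_polar u v z + cubic_polar u' v z"
  "cubic_polar (c *s u) v z = c * cubic_polar u v z"
proof -
  have c: "cubic_part z (u + u') v = cubic_part (u + u') z v"
    "cubic_part z (c *s u) v = cubic_part (c *s u) z v"
    "cubic_part z u v = cubic_part u z v" "cubic_part z u' v = cubic_part u' z v"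
    by (rule cubic_part_commute)+
  show "cubic_polar (u + u') v z = cubic_polar u v z + cubic_polar u' v z"
    "cubic_polar (c *s u) v z = c * cubic_polar u v z"
    by (simp_all add: cubic_polar_def cubic_part_linear c algebra_simps)
qed

lemma cubic_polar_linear:
  "cubic_polar (u + u') v z = cubic_polar u v z + cubic_polar u' v z"
  "cubic_polar (c *s u) v z = c * cubic_polar u v z"
  "cubic_polar v (u + u') z = cubic_polar v u z + cubic_polar v u' z"
  "cubic_polar v (c *s u) z = c * cubic_polar v u z"
  "cubic_polar v z (u + u') = cubic_polar v z u + cubic_polar v z u'"
  "cubic_polar v z (c *s u) = c * cubic_polar v z u"
  by (metis cubic_polar_linear1 cubic_polar_rotate)+

lemma cubic_polar_zero [simp]:
  "cubic_polar 0 v z = 0" "cubic_polar v 0 z = 0" "cubic_polar v z 0 = 0"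
proof -
  show *: "cubic_polar 0 v z = 0" for v z
    using cubic_polar_linear(2)[of 0 0 v z] by simp
  show "cubic_polar v 0 z = 0" "cubic_polar v z 0 = 0"
    by (metis * cubic_polar_rotate)+
qed

lemma cubic_polar_diff:
  "cubic_polar (u - u') v z = cubic_polar u v z - cubic_polar u' v z"
  by (metis add_diff_cancel diff_add_cancel cubic_polar_linear1(1))

lemma cubic_polar_sum: "cubic_polar (sum g S) v z = (\<Sum>i\<in>S. cubic_polar (g i) v z)"
  by (induct S rule: infinite_finite_induct) (simp_all add: cubic_polar_linear)

lemma q_polar_diag: "q_polar i v v = 2 * q i v"
  by (simp add: q_polar_def q_def Pf_polar_def Pf_def pfaffian4_def Let_def algebra_simps)

lemma q'_polar_diag: "q'_polar i v v = 2 * q' i v"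
  by (simp add: q'_polar_def q'_def sum_distrib_left mult.commute)

lemma cubic_polar_diag: "cubic_polar v v v = 6 * F_C v"
proof -
  have "cubic_part v v v = 2 * F_C v"
    by (simp add: cubic_part_def F_C_def F_def q_polar_diag q'_polar_diag sum_subtractf
        sum.distrib sum_distrib_left sum_distrib_right algebra_simps)
  then show ?thesis by (simp add: cubic_polar_def)
qed

text \<open>
  The Taylor expansion of \<open>F_C\<close>; its linear term identifies the partial derivatives with the values of
  the polar form.
\<close>

lemma cubic_polar_add:
  "F_C (v + t *s u) = F_C v + t * (cubic_polar v v u / 2) + t\<^sup>2 * (cubic_polar v u u / 2) + t ^ 3 * F_C u"
proof -
  have "cubic_polar v u v = cubic_polar v v u" "cubic_polar u v v = cubic_polar v v u"
    "cubic_polar u v u = cubic_polar v u u" "cubic_polar u u v = cubic_polar v u u"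
    by (metis cubic_polar_commute cubic_polar_rotate)+
  then have "6 * F_C (v + t *s u) = 6 * F_C v + 3 * t * cubic_polar v v u
      + 3 * t\<^sup>2 * cubic_polar v u u + 6 * t ^ 3 * F_C u"
    unfolding cubic_polar_diag[symmetric]
    by (simp add: cubic_polar_linear algebra_simps power2_eq_square power3_eq_cube
        cubic_polar_diag[of u])
  also have "\<dots> = 6 * (F_C v + t * (cubic_polar v v u / 2) + t\<^sup>2 * (cubic_polar v u u / 2) + t ^ 3 * F_C u)"
    by (simp add: algebra_simps)
  finally show ?thesis by (simp only: mult_cancel_left) simp
qed

lemma partial_F_C: "partial k F_C v = cubic_polar v v (axis k 1) / 2"
  unfolding partial_def cubic_polar_add
  by (rule DERIV_imp_deriv) (auto intro!: derivative_eq_intros)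

section \<open>Invariance under the Lie algebra\<close>

text \<open>
  The derivation of the trilinear form induced by \<open>M\<close> vanishes.  Stated for three arguments instead of on
  the diagonal, the condition is visibly preserved by brackets.
\<close>

definition annihilates :: "cmat \<Rightarrow> bool" where
  "annihilates M \<longleftrightarrow> (\<forall>x y z. 
     cubic_polar (M *v x) y z + cubic_polar x (M *v y) z + cubic_polar x y (M *v z) = 0)"

text \<open>Polarisation: in characteristic 0 a symmetric trilinear form is determined by its cubic form.\<close>

lemma symmetric_trilinear_vanishes:
  fixes T :: "cvec \<Rightarrow> cvec \<Rightarrow> cvec \<Rightarrow> complex"
  assumes add: "\<And>u u' v z. T (u + u') v z = T u v z + T u' v z"
    and rot: "\<And>u v z. T u v z = T v z u" and com: "\<And>u v z. T u v z = T v u z"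
    and diag: "\<And>v. T v v v = 0"
  shows "T x y z = 0"
proof -
  have add2: "T v (u + u') z = T v u z + T v u' z" for u u' v z by (metis add com)
  have add3: "T v z (u + u') = T v z u + T v z u'" for u u' v z by (metis add rot)
  have two: "T u u v + T u v v = 0" for u v
  proof -
    have "T u v u = T u u v" "T v u u = T u u v" "T v u v = T u v v" "T v v u = T u v v"
      by (metis rot com)+
    then have "T (u + v) (u + v) (u + v) = 3 * (T u u v + T u v v)"
      by (simp add: add add2 add3 diag[of u] diag[of v])
    then show ?thesis using diag[of "u + v"] by (metis mult_eq_0_iff zero_neq_numeral)
  qed
  have two': "T u u v = 0" for u v
  proof -
    have "T (u + u) (u + u) v + T (u + u) v v = 0" by (rule two)
    then have "2 * T u u v + (2 * T u u v + 2 * T u v v) = 0"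
      unfolding add add2 by (simp add: algebra_simps)
    also have "2 * T u u v + 2 * T u v v = 2 * (T u u v + T u v v)" by simp
    finally show ?thesis by (simp add: two)
  qed
  have "T (x + y) (x + y) z = 2 * T x y z"
    by (simp add: add add2 two'[of x] two'[of y] com[of y x])
  then show ?thesis by (metis mult_eq_0_iff two' zero_neq_numeral)
qed

lemma annihilatesI:
  assumes "\<And>v. cubic_polar v v (M *v v) = 0"
  shows "annihilates M"
  unfolding annihilates_def
proof (intro allI)
  fix x y z
  define T where "T x y z = cubic_polar (M *v x) y z + cubic_polar x (M *v y) z + cubic_polar x y (M *v z)" for x y z
  have "T x y z = 0"
  proof (rule symmetric_trilinear_vanishes)
    show "T (u + u') v z = T u v z + T u' v z" for u u' v z
      by (simp add: T_def cubic_polar_linear matrix_vector_right_distrib)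
    show "T u v z = T v z u" for u v z
      unfolding T_def by (metis add.assoc add.commute cubic_polar_rotate)
    show "T u v z = T v u z" for u v z
      unfolding T_def by (metis add.commute cubic_polar_commute)
    show "T v v v = 0" for v
      unfolding T_def by (metis add.right_neutral assms cubic_polar_rotate)
  qed
  then show "cubic_polar (M *v x) y z + cubic_polar x (M *v y) z + cubic_polar x y (M *v z) = 0"
    by (simp add: T_def)
qed

lemma annihilates_lie_algebra:
  assumes "M \<in> lie_algebra S" "\<And>M. M \<in> S \<Longrightarrow> annihilates M"
  shows "annihilates M"
  using assms(1)
proof induct
  case (bracket M N)
  let ?C = cubic_polar
  have M: "?C (M *v x) y z + ?C x (M *v y) z + ?C x y (M *v z) = 0"
    and N: "?C (N *v x) y z + ?C x (N *v y) z + ?C x y (N *v z) = 0" for x y z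
    using bracket(2,4) by (auto simp: annihilates_def)
  have diff: "?C (u - u') v z = ?C u v z - ?C u' v z" "?C v (u - u') z = ?C v u z - ?C v u' z"
    "?C v z (u - u') = ?C v z u - ?C v z u'" for u u' v z
    by (metis cubic_polar_diff cubic_polar_rotate)+
  show ?case
    unfolding annihilates_def bracket_apply diff
  proof (intro allI)
    fix x y z
    show "?C (M *v (N *v x)) y z - ?C (N *v (M *v x)) y z
        + (?C x (M *v (N *v y)) z - ?C x (N *v (M *v y)) z)
        + (?C x y (M *v (N *v z)) - ?C x y (N *v (M *v z))) = 0"
      using M[of "N *v x" y z] M[of x "N *v y" z] M[of x y "N *v z"]
        N[of "M *v x" y z] N[of x "M *v y" z] N[of x y "M *v z"]
      by (simp add: algebra_simps) algebra
  qed
next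
  case (scale M c)
  then show ?case
    by (simp add: annihilates_def cubic_polar_linear flip: distrib_left)
next
  case (add M N)
  then show ?case
    by (simp add: annihilates_def cubic_polar_linear matrix_vector_mult_add_rdistrib)
      (metis add.assoc add.left_commute add_0)
qed (use assms(2) in \<open>auto simp: annihilates_def\<close>)

lemmas cubic_evaluation = cubic_polar_def cubic_part_def q_polar_def q'_polar_def Pf_polar_def
  Let_def sum_5 skip_def P_entry_def

lemma annihilates_e: "\<forall>i\<in>{1..6}. annihilates (e6 i)"
  unfolding forall_nodes
  by (intro conjI annihilatesI;
      simp add: cubic_evaluation two_Suc raise_def sl5_elem_def slot_def algebra_simps)

lemma annihilates_f: "\<forall>i\<in>{1..6}. annihilates (f6 i)"
  unfolding forall_nodes
  by (intro conjI annihilatesI;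
      simp add: cubic_evaluation two_Suc lower_def sl5_elem_def slot_def algebra_simps)

section \<open>The abelian nilradical\<close>

text \<open>
  The operator belonging to a spinor \<open>s\<close> sends \<open>w\<close> to \<open>s\<close>, a spinor to the vector obtained by polarising
  the quadratic map \<open>(q', q)\<close>, and vectors to 0.  These operators form the abelian nilradical of the
  parabolic subalgebra opposite to the stabiliser of the highest weight line.
\<close>

definition nilradical_comp :: "cvec \<Rightarrow> cvec \<Rightarrow> label \<Rightarrow> complex" where
  "nilradical_comp s v l = (case l of
      La i \<Rightarrow> q'_polar i s v
    | Lb i \<Rightarrow> q_polar i s v
    | Lw \<Rightarrow> 0
    | _ \<Rightarrow> var l s * var Lw v)"

definition nilradical :: "cvec \<Rightarrow> cmat" where
  "nilradical s = matrix (\<lambda>v. vec_of (nilradical_comp s v))"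

lemma nilradical_apply: "nilradical s *v v = vec_of (nilradical_comp s v)"
  unfolding nilradical_def
  apply (rule matrix_labels)
  subgoal for l u v
    by (cases l) (simp_all add: nilradical_comp_def q_polar_commute[of _ s]
       q'_polar_commute[of _ s] q_polar_linear q'_polar_linear distrib_left)
  subgoal for l c v
    by (cases l) (simp_all add: nilradical_comp_def q_polar_commute[of _ s]
       q'_polar_commute[of _ s] q_polar_linear q'_polar_linear)
  done

lemma var_nilradical [simp]: "l \<in> labels \<Longrightarrow> var l (nilradical s *v v) = nilradical_comp s v l"
  by (simp add: nilradical_apply)

text \<open>
  Lowering operators of \<open>so(10)\<close> act on the nilradical as on the spinors, since the polarised quadratic
  map is equivariant.
\<close>

lemma bracket_f_nilradical: "\<forall>i\<in>{1..6}. i \<noteq> 1 \<longrightarrow> bracket (f6 i) (nilradical s) = nilradical (f6 i *v s)"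
  unfolding forall_nodes
  by (intro conjI; simp add: matrix_eq_labels labels_eq bracket_apply cubic_evaluation two_Suc
      lower_def sl5_elem_def slot_def nilradical_comp_def algebra_simps)

lemma nilradical_linear:
  "nilradical (s + s') = nilradical s + nilradical s'"
  "nilradical (c *s s) = mat c ** nilradical s"
  by (rule matrix_eqI_labels;
     auto simp: labels_decomp spinor_labels_def nilradical_comp_def matrix_vector_mult_add_rdistrib
       q_polar_linear q'_polar_linear algebra_simps)+

lemma nilradical_x0: "nilradical (unit Lx0) = f6 1"
  by (simp add: matrix_eq_labels labels_eq nilradical_comp_def lower_def cubic_evaluation)

section \<open>The matrix exponential\<close>

definition mpow :: "cmat \<Rightarrow> nat \<Rightarrow> cmat" where
  "mpow M n = (((**) M) ^^ n) (mat 1)"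

lemma mpow_simps [simp]: "mpow M 0 = mat 1" "mpow M (Suc n) = M ** mpow M n"
  by (simp_all add: mpow_def)

lemma mpow_commute: "M ** mpow M n = mpow M n ** M"
  by (induct n) (simp_all, metis matrix_mul_assoc)

lemma mat_vec: "mat c *v v = c *s (v :: cvec)"
  using mat_apply[of c "mat 1" v] by (simp del: mat_apply)

lemma mpow_scale: "mpow (mat t ** M) n = mat (t ^ n) ** mpow M n"
proof (induct n)
  case (Suc n)
  show ?case
    unfolding mpow_simps Suc matrix_eq
    by (simp add: matrix_vector_mul_assoc[symmetric] mat_vec vector_scalar_commute vector_smult_assoc)
qed simp

lemma mat_mult_entry: "(mat c ** M) $ i $ j = c * (M :: cmat) $ i $ j"
  by (simp add: matrix_matrix_mult_def mat_def if_distrib[where f="\<lambda>x. x * _"] cong: if_cong)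

definition entry_sum :: "cmat \<Rightarrow> real" where
  "entry_sum M = (\<Sum>i\<in>UNIV. \<Sum>j\<in>UNIV. norm (M $ i $ j))"

text \<open>
  The absolute values in each row of \<open>M\<close> add up to at most the sum over all entries, so the entries of
  the powers grow at most geometrically and the exponential series converges entrywise.
\<close>

lemma mpow_bound: "norm (mpow M n $ i $ j) \<le> entry_sum M ^ n"
proof (induct n arbitrary: i)
  case 0
  show ?case by (simp add: mat_def)
next
  case (Suc n)
  have nn: "0 \<le> entry_sum M" by (simp add: entry_sum_def sum_nonneg)
  have "norm (mpow M (Suc n) $ i $ j) \<le> (\<Sum>k\<in>UNIV. norm (M $ i $ k * mpow M n $ k $ j))"
    by (simp add: matrix_matrix_mult_def norm_sum)
  also have "\<dots> \<le> (\<Sum>k\<in>UNIV. norm (M $ i $ k) * entry_sum M ^ n)"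
    by (intro sum_mono) (simp add: norm_mult mult_left_mono Suc)
  also have "\<dots> = (\<Sum>k\<in>UNIV. norm (M $ i $ k)) * entry_sum M ^ n"
    by (simp add: sum_distrib_right)
  also have "\<dots> \<le> entry_sum M * entry_sum M ^ n"
  proof (rule mult_right_mono)
    show "(\<Sum>k\<in>UNIV. norm (M $ i $ k)) \<le> entry_sum M"
      unfolding entry_sum_def by (rule member_le_sum) (auto simp: sum_nonneg)
  qed (use nn in simp)
  finally show ?case by simp
qed

lemma summable_exp_entry: "summable (\<lambda>n. mpow M n $ i $ j / fact n * t ^ n)"
proof (rule summable_comparison_test)
  show "summable (\<lambda>n. inverse (fact n) * (entry_sum M * norm t) ^ n)"
    by (rule summable_exp)
  show "\<exists>N. \<forall>n\<ge>N. norm (mpow M n $ i $ j / fact n * t ^ n) \<le> inverse (fact n) * (entry_sum M * norm t) ^ n"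
  proof (intro exI[of _ 0] allI impI)
    fix n
    have "norm (mpow M n $ i $ j / fact n * t ^ n) = inverse (fact n) * (norm (mpow M n $ i $ j) * norm t ^ n)"
      by (simp add: norm_mult norm_divide norm_power norm_inverse divide_inverse)
    also have "\<dots> \<le> inverse (fact n) * (entry_sum M ^ n * norm t ^ n)"
      by (intro mult_left_mono mult_right_mono mpow_bound) auto
    finally show "norm (mpow M n $ i $ j / fact n * t ^ n) \<le> inverse (fact n) * (entry_sum M * norm t) ^ n"
      by (simp add: power_mult_distrib)
  qed
qed

lemma mat_exp_entry: "mat_exp (mat t ** M) $ i $ j = (\<Sum>n. mpow M n $ i $ j / fact n * t ^ n)"
proof -
  define X where "X n = mpow (mat t ** M) n /\<^sub>R fact n" for n
  have X: "X n $ i $ j = mpow M n $ i $ j / fact n * t ^ n" for n i j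
    by (simp add: X_def mpow_scale mat_mult_entry) (simp add: scaleR_conv_of_real field_simps)
  have lim: "(\<lambda>n. (\<Sum>m<n. X m)) \<longlonglongrightarrow> (\<chi> i j. \<Sum>n. X n $ i $ j)"
  proof (intro vec_tendstoI)
    fix i j
    have "(\<lambda>n. \<Sum>m<n. X m $ i $ j) \<longlonglongrightarrow> (\<Sum>n. X n $ i $ j)"
      using summable_exp_entry[of M i j t] by (intro summable_LIMSEQ) (simp add: X)
    then show "(\<lambda>n. (\<Sum>m<n. X m) $ i $ j) \<longlonglongrightarrow> (\<chi> i j. \<Sum>n. X n $ i $ j) $ i $ j"
      by simp
  qed
  then have "X sums (\<chi> i j. \<Sum>n. X n $ i $ j)" by (simp add: sums_def)
  then have "(\<chi> i j. \<Sum>n. X n $ i $ j) = suminf X" by (rule sums_unique)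
  also have "suminf X = mat_exp (mat t ** M)"
    by (simp only: mat_exp_def X_def[abs_def] mpow_def)
  finally have "mat_exp (mat t ** M) = (\<chi> i j. \<Sum>n. X n $ i $ j)" ..
  then show ?thesis by (simp add: X)
qed

lemma mat_exp_0 [simp]: "mat_exp 0 = mat 1"
proof -
  have "mat_exp (mat 0 ** 0) $ i $ j = mat 1 $ i $ j" for i j
    unfolding mat_exp_entry by (subst powser_zero) simp
  then show ?thesis by (simp add: vec_eq_iff)
qed

lemma
  mat_exp_deriv_right: "((\<lambda>t. mat_exp (mat t ** M) $ i $ j) has_field_derivative
     (mat_exp (mat t ** M) ** M) $ i $ j) (at t)" (is ?R)
  and mat_exp_deriv: "((\<lambda>t. mat_exp (mat t ** M) $ i $ j) has_field_derivative
     (M ** mat_exp (mat t ** M)) $ i $ j) (at t)" (is ?L)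
proof -
  let ?c = "\<lambda>n. mpow M n $ i $ j / fact n"
  have D: "((\<lambda>t. \<Sum>n. ?c n * t ^ n) has_field_derivative (\<Sum>n. diffs ?c n * t ^ n)) (at t)"
    by (rule termdiffs_strong_converges_everywhere) (rule summable_exp_entry)
  have diffs: "diffs ?c n = mpow M (Suc n) $ i $ j / fact n" for n
    by (simp add: diffs_def del: mpow_simps of_nat_Suc)
  have "(\<Sum>n. diffs ?c n * t ^ n) = (\<Sum>n. \<Sum>k\<in>UNIV. M $ i $ k * (mpow M n $ k $ j / fact n * t ^ n))"
    unfolding diffs by (simp add: matrix_matrix_mult_def sum_distrib_right sum_divide_distrib mult.assoc)
  also have "\<dots> = (\<Sum>k\<in>UNIV. \<Sum>n. M $ i $ k * (mpow M n $ k $ j / fact n * t ^ n))"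
    by (rule suminf_sum) (intro summable_mult summable_exp_entry)
  also have "\<dots> = (M ** mat_exp (mat t ** M)) $ i $ j"
    unfolding suminf_mult[OF summable_exp_entry]
    by (simp add: matrix_matrix_mult_def[of M] mat_exp_entry)
  finally show ?L using D by (simp add: mat_exp_entry)
  have "(\<Sum>n. diffs ?c n * t ^ n) = (\<Sum>n. \<Sum>k\<in>UNIV. (mpow M n $ i $ k / fact n * t ^ n) * M $ k $ j)"
    unfolding diffs mpow_simps mpow_commute
    by (simp add: matrix_matrix_mult_def sum_distrib_right sum_distrib_left sum_divide_distrib mult_ac)
  also have "\<dots> = (\<Sum>k\<in>UNIV. \<Sum>n. (mpow M n $ i $ k / fact n * t ^ n) * M $ k $ j)"
    by (rule suminf_sum) (intro summable_mult2 summable_exp_entry)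
  also have "\<dots> = (mat_exp (mat t ** M) ** M) $ i $ j"
    unfolding suminf_mult2[OF summable_exp_entry, symmetric]
    by (simp add: matrix_matrix_mult_def[of "mat_exp _" M] mat_exp_entry)
  finally show ?R using D by (simp add: mat_exp_entry)
qed

text \<open>
  The curve \<open>exp (t M) v\<close> solves the linear differential equation \<open>x' = M x\<close>.  All facts about
  exponentials below are obtained by exhibiting a function with zero derivative along such curves.
\<close>

lemma flow_deriv:
  "((\<lambda>t. (mat_exp (mat t ** M) *v v) $ k) has_field_derivative (M *v (mat_exp (mat t ** M) *v v)) $ k) (at t)"
proof -
  have "((\<lambda>t. \<Sum>j\<in>UNIV. mat_exp (mat t ** M) $ k $ j * v $ j) has_field_derivative
     (\<Sum>j\<in>UNIV. (M ** mat_exp (mat t ** M)) $ k $ j * v $ j)) (at t)"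
    by (intro DERIV_sum DERIV_cmult_right mat_exp_deriv)
  then show ?thesis
    by (simp add: matrix_vector_mul_assoc) (simp add: matrix_vector_mult_def)
qed

lemma constant_if_deriv_zero:
  fixes g :: "complex \<Rightarrow> complex"
  assumes "\<And>t. (g has_field_derivative 0) (at t)"
  shows "g t = g 0"
  using has_field_derivative_zero_constant[of UNIV g] assms by auto

lemma mat_exp_inverse: "mat_exp M ** mat_exp (- M) = mat 1"
proof -
  define A where "A t = mat_exp (mat t ** M)" for t
  define g where "g i j t = (A t ** A (- t)) $ i $ j" for i j t
  have "(g i j has_field_derivative 0) (at t)" for i j t
  proof -
    have "((\<lambda>t. \<Sum>k\<in>UNIV. A t $ i $ k * A (- t) $ k $ j) has_field_derivative
       (\<Sum>k\<in>UNIV. (A t ** M) $ i $ k * A (- t) $ k $ j + (- (M ** A (- t)) $ k $ j) * A t $ i $ k)) (at t)"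
    proof (intro DERIV_sum DERIV_mult)
      fix k
      show "((\<lambda>t. A t $ i $ k) has_field_derivative (A t ** M) $ i $ k) (at t)"
        unfolding A_def by (rule mat_exp_deriv_right)
      have "((\<lambda>t. mat_exp (mat t ** M) $ k $ j) \<circ> uminus has_field_derivative
          (M ** mat_exp (mat (- t) ** M)) $ k $ j * (- 1)) (at t)"
        by (rule DERIV_chain[OF mat_exp_deriv]) (auto intro!: derivative_eq_intros)
      then show "((\<lambda>t. A (- t) $ k $ j) has_field_derivative - (M ** A (- t)) $ k $ j) (at t)"
        by (simp add: A_def o_def)
    qed
    moreover have "(\<Sum>k\<in>UNIV. (A t ** M) $ i $ k * A (- t) $ k $ j + (- (M ** A (- t)) $ k $ j) * A t $ i $ k)
      = ((A t ** M) ** A (- t)) $ i $ j - (A t ** (M ** A (- t))) $ i $ j"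
      by (simp add: matrix_matrix_mult_def[of "A t ** M"] matrix_matrix_mult_def[of "A t" "M ** _"]
          sum.distrib sum_negf sum_subtractf mult.commute)
    ultimately show ?thesis
      by (simp add: g_def[abs_def] matrix_mul_assoc) (simp add: matrix_matrix_mult_def[of "A _" "A _"])
  qed
  then have "g i j 1 = g i j 0" for i j by (rule constant_if_deriv_zero)
  then have "A 1 ** A (- 1) = A 0 ** A 0" by (simp add: g_def vec_eq_iff)
  moreover have "mat (- 1) ** M = - M" by (simp add: vec_eq_iff mat_mult_entry)
  ultimately show ?thesis by (simp add: A_def)
qed

section \<open>The group generated by exponentials\<close>

lemma exp_group_mult:
  assumes "g \<in> exp_group S" "g' \<in> exp_group S" shows "g ** g' \<in> exp_group S"
  using assms(1)
  by induct (simp_all add: assms(2) exp_group.mult flip: matrix_mul_assoc)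

lemma mat_exp_in_group: "M \<in> S \<Longrightarrow> mat_exp M \<in> exp_group S"
  using exp_group.mult[OF _ exp_group.one] by force

lemma lie_algebra_uminus: "M \<in> lie_algebra S \<Longrightarrow> - M \<in> lie_algebra S"
proof -
  assume "M \<in> lie_algebra S"
  then have "mat (- 1) ** M \<in> lie_algebra S" by (rule lie_algebra.scale)
  moreover have "mat (- 1) ** M = - M" by (simp add: vec_eq_iff mat_mult_entry)
  ultimately show ?thesis by simp
qed

lemma exp_group_inverse:
  assumes "g \<in> exp_group (lie_algebra S)"
  obtains g' where "g' \<in> exp_group (lie_algebra S)" "g' ** g = mat 1" "g ** g' = mat 1"
proof -
  from assms have "\<exists>g' \<in> exp_group (lie_algebra S). g ** g' = mat 1"
  proof induct
    case one
    then show ?case using exp_group.one by force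
  next
    case (mult M N)
    then obtain N' where N': "N' \<in> exp_group (lie_algebra S)" "N ** N' = mat 1" by blast
    have "mat_exp M ** N ** (N' ** mat_exp (- M)) = mat_exp M ** (N ** N') ** mat_exp (- M)"
      by (simp add: matrix_mul_assoc)
    also have "\<dots> = mat 1" by (simp add: N' mat_exp_inverse)
    finally show ?case
      using exp_group_mult[OF N'(1) mat_exp_in_group[OF lie_algebra_uminus[OF mult(1)]]] by blast
  qed
  then show ?thesis using that matrix_left_right_inverse by blast
qed

text \<open>Each coordinate of the flow, multiplied by the inverse exponential, is constant.\<close>

lemma diag_exp: "mat_exp (diag d) *v v = (\<chi> k. exp (d k) * v $ k)"
proof -
  have "(mat_exp (diag d) *v v) $ k = exp (d k) * v $ k" for k
  proof -
    define g where "g t = exp (- (t * d k)) * (mat_exp (mat t ** diag d) *v v) $ k" for t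
    have "(g has_field_derivative 0) (at t)" for t
      unfolding g_def by (auto intro!: derivative_eq_intros flow_deriv)
    then have "g 1 = g 0" by (rule constant_if_deriv_zero)
    then have "exp (- d k) * (mat_exp (diag d) *v v) $ k = v $ k" by (simp add: g_def)
    then have "exp (d k) * (exp (- d k) * (mat_exp (diag d) *v v) $ k) = exp (d k) * v $ k" by simp
    then show ?thesis by (simp add: exp_minus field_simps)
  qed
  then show ?thesis by (simp add: vec_eq_iff)
qed

section \<open>Forms and Zariski closed sets\<close>

lemma finite_exponents: "finite {m :: coord \<Rightarrow> nat. (\<Sum>k\<in>UNIV. m k) = d}"
proof (rule finite_subset)
  show "{m :: coord \<Rightarrow> nat. (\<Sum>k\<in>UNIV. m k) = d} \<subseteq> Pi\<^sub>E UNIV (\<lambda>_. {..d})"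
    using member_le_sum[of _ UNIV] by (force simp: PiE_def)
qed (simp add: finite_PiE)

lemma homogeneous_add:
  assumes "homogeneous d g" "homogeneous d g'" shows "homogeneous d (\<lambda>v. g v + g' v)"
proof -
  from assms obtain c c' where
    "\<And>v. g v = (\<Sum>m \<in> {m. (\<Sum>k\<in>UNIV. m k) = d}. c m * (\<Prod>k\<in>UNIV. (v $ k) ^ m k))"
    "\<And>v. g' v = (\<Sum>m \<in> {m. (\<Sum>k\<in>UNIV. m k) = d}. c' m * (\<Prod>k\<in>UNIV. (v $ k) ^ m k))"
    unfolding homogeneous_def by blast
  then show ?thesis
    unfolding homogeneous_def
    by (intro exI[of _ "\<lambda>m. c m + c' m"]) (simp add: distrib_right sum.distrib)
qed

lemma homogeneous_scale:
  assumes "homogeneous d g" shows "homogeneous d (\<lambda>v. a * g v)"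
proof -
  from assms obtain c where
    "\<And>v. g v = (\<Sum>m \<in> {m. (\<Sum>k\<in>UNIV. m k) = d}. c m * (\<Prod>k\<in>UNIV. (v $ k) ^ m k))"
    unfolding homogeneous_def by blast
  then show ?thesis
    unfolding homogeneous_def
    by (intro exI[of _ "\<lambda>m. a * c m"]) (simp add: sum_distrib_left mult.assoc)
qed

lemma homogeneous_zero: "homogeneous d (\<lambda>v. 0)"
  unfolding homogeneous_def by (intro exI[of _ "\<lambda>m. 0"]) simp

lemma homogeneous_sum: "(\<And>i. i \<in> S \<Longrightarrow> homogeneous d (g i)) \<Longrightarrow> homogeneous d (\<lambda>v. \<Sum>i\<in>S. g i v)"
  by (induct S rule: infinite_finite_induct) (simp_all add: homogeneous_zero homogeneous_add)

lemma homogeneous_one: "homogeneous 0 (\<lambda>v. 1)"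
proof -
  have "{m :: coord \<Rightarrow> nat. (\<Sum>k\<in>UNIV. m k) = 0} = {\<lambda>k. 0}" by auto
  then show ?thesis
    unfolding homogeneous_def by (intro exI[of _ "\<lambda>m. 1"]) simp
qed

text \<open>
  Multiplying by a coordinate raises one exponent of each monomial; the coefficients are transported along
  this injection of exponent functions.
\<close>

lemma homogeneous_coord_mult:
  assumes "homogeneous d g" shows "homogeneous (Suc d) (\<lambda>v. v $ k * g v)"
proof -
  from assms obtain c where c:
    "\<And>v. g v = (\<Sum>m \<in> {m. (\<Sum>k\<in>UNIV. m k) = d}. c m * (\<Prod>k\<in>UNIV. (v $ k) ^ m k))"
    unfolding homogeneous_def by blast
  define inc where "inc m = m(k := Suc (m k))" for m :: "coord \<Rightarrow> nat"
  define dec where "dec m = m(k := m k - 1)" for m :: "coord \<Rightarrow> nat"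
  have dec_inc: "dec (inc m) = m" for m by (simp add: inc_def dec_def)
  have total: "(\<Sum>j\<in>UNIV. inc m j) = Suc (\<Sum>j\<in>UNIV. m j)" for m
    by (simp add: inc_def sum.remove[of UNIV k])
  have monomial: "v $ k * (\<Prod>j\<in>UNIV. (v $ j) ^ m j) = (\<Prod>j\<in>UNIV. (v $ j) ^ inc m j)" for v :: cvec and m
    by (simp add: inc_def prod.remove[of UNIV k] mult.assoc)
  let ?M = "\<lambda>d. {m :: coord \<Rightarrow> nat. (\<Sum>j\<in>UNIV. m j) = d}"
  let ?c = "\<lambda>m. if m \<in> inc ` ?M d then c (dec m) else 0"
  have "v $ k * g v = (\<Sum>m\<in>?M (Suc d). ?c m * (\<Prod>j\<in>UNIV. (v $ j) ^ m j))" for v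
  proof -
    have "v $ k * g v = (\<Sum>m\<in>?M d. c m * (\<Prod>j\<in>UNIV. (v $ j) ^ inc m j))"
      by (simp add: c sum_distrib_left mult.left_commute[of "v $ k"] monomial)
    also have "\<dots> = (\<Sum>m\<in>inc ` ?M d. c (dec m) * (\<Prod>j\<in>UNIV. (v $ j) ^ m j))"
      by (subst sum.reindex) (auto intro: inj_on_inverseI dec_inc simp: dec_inc)
    also have "\<dots> = (\<Sum>m\<in>?M (Suc d). ?c m * (\<Prod>j\<in>UNIV. (v $ j) ^ m j))"
      by (rule sum.mono_neutral_cong_left) (use total finite_exponents in auto)
    finally show ?thesis .
  qed
  then show ?thesis unfolding homogeneous_def by (intro exI[of _ ?c] allI)
qed

lemma homogeneous_var_mult: "homogeneous d g \<Longrightarrow> homogeneous (Suc d) (\<lambda>v. var l v * g v)"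
  unfolding var_def by (rule homogeneous_coord_mult)

lemma homogeneous_var: "homogeneous 1 (var l)"
  using homogeneous_var_mult[OF homogeneous_one, of l] by simp

lemma homogeneous_cmul:
  assumes "homogeneous d g" shows "g (c *s v) = c ^ d * g v"
  using assms unfolding homogeneous_def
  by (force simp: power_mult_distrib prod.distrib sum_distrib_left mult_ac simp flip: power_sum intro!: sum.cong)

lemma homogeneous_continuous: 
  assumes "homogeneous d g" shows "continuous_on UNIV g"
proof -
  from assms obtain c where
    "g = (\<lambda>v. \<Sum>m \<in> {m. (\<Sum>k\<in>UNIV. m k) = d}. c m * (\<Prod>k\<in>UNIV. (v $ k) ^ m k))"
    unfolding homogeneous_def by blast
  then show ?thesis by (auto intro!: continuous_intros)
qed

lemma homogeneous_on_line:
  assumes "homogeneous d g" obtains p where "\<forall>t. g (u + t *s v) = poly p t"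
proof -
  from assms obtain c where c:
    "\<And>v. g v = (\<Sum>m \<in> {m. (\<Sum>k\<in>UNIV. m k) = d}. c m * (\<Prod>k\<in>UNIV. (v $ k) ^ m k))"
    unfolding homogeneous_def by blast
  show thesis
    by (rule that[of "\<Sum>m \<in> {m. (\<Sum>k\<in>UNIV. m k) = d}. smult (c m) (\<Prod>k\<in>UNIV. [:u $ k, v $ k:] ^ m k)"])
       (simp add: c poly_sum poly_prod poly_power)
qed

lemma in_PP: "L \<in> PP \<longleftrightarrow> (\<exists>v. v \<noteq> 0 \<and> L = vec.span {v})"
  by (auto simp: PP_def)

lemma span_point: "vec.span {v} = {c *s v | c. True}"
  by (auto simp: vec.span_singleton)

lemma span_scale:
  assumes "c \<noteq> 0" shows "vec.span {c *s v} = vec.span {v :: cvec}"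
proof -
  have "a *s v = (a / c) *s (c *s v)" for a
    using assms by (simp add: vector_smult_assoc)
  then show ?thesis
    unfolding span_point by (metis (no_types, opaque_lifting) vector_smult_assoc)
qed

lemma in_zero_locus:
  assumes "v \<noteq> 0" "\<And>g. g \<in> S \<Longrightarrow> \<exists>d. homogeneous d g"
  shows "vec.span {v} \<in> zero_locus S \<longleftrightarrow> (\<forall>g\<in>S. g v = 0)"
proof -
  have P: "vec.span {v} \<in> PP" using assms(1) by (auto simp: in_PP)
  have self: "v \<in> vec.span {v}" by (simp add: vec.span_base)
  have "g (c *s v) = 0" if "g \<in> S" "g v = 0" for g c
    using assms(2)[OF that(1)] homogeneous_cmul that(2) by fastforce
  then have "\<forall>u\<in>vec.span {v}. g u = 0" if "g \<in> S" "g v = 0" for g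
    using that unfolding span_point by blast
  then show ?thesis
    using P self unfolding zero_locus_def by blast
qed

lemma zero_locus_Un: "zero_locus (S \<union> T) = zero_locus S \<inter> zero_locus T"
  by (auto simp: zero_locus_def)

lemma zariski_closedE:
  assumes "zariski_closed Z"
  obtains S where "\<forall>g\<in>S. \<exists>d. homogeneous d g" "Z = zero_locus S"
  using assms unfolding zariski_closed_def by metis

text \<open>
  If neither of two closed sets contains the linear space, some form of each set of equations is nonzero at
  a point of it.  On the line joining these two points both forms are nonzero polynomials, so they have a
  common non-root.
\<close>

lemma linear_irreducible:
  assumes U: "vec.subspace U" and u0: "u0 \<in> U" "u0 \<noteq> 0"
  shows "zariski_irreducible {L \<in> PP. L \<subseteq> U}"
  unfolding zariski_irreducible_def
proof (intro conjI allI impI)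
  have sub: "vec.span {u} \<subseteq> U" if "u \<in> U" for u
    using U that by (simp add: vec.span_minimal)
  show "{L \<in> PP. L \<subseteq> U} \<noteq> {}"
    using sub[OF u0(1)] u0(2) by (auto simp: in_PP)
  fix Z1 Z2
  assume Z: "zariski_closed Z1" "zariski_closed Z2" and cover: "{L \<in> PP. L \<subseteq> U} \<subseteq> Z1 \<union> Z2"
  obtain S1 where S1: "\<forall>g\<in>S1. \<exists>d. homogeneous d g" "Z1 = zero_locus S1"
    using Z(1) by (rule zariski_closedE)
  obtain S2 where S2: "\<forall>g\<in>S2. \<exists>d. homogeneous d g" "Z2 = zero_locus S2"
    using Z(2) by (rule zariski_closedE)
  show "{L \<in> PP. L \<subseteq> U} \<subseteq> Z1 \<or> {L \<in> PP. L \<subseteq> U} \<subseteq> Z2"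
  proof (rule ccontr)
    assume "\<not> ?thesis"
    then obtain L1 L2 where L: "L1 \<in> PP" "L1 \<subseteq> U" "L1 \<notin> Z1" "L2 \<in> PP" "L2 \<subseteq> U" "L2 \<notin> Z2" by blast
    obtain v1 where v1: "v1 \<noteq> 0" "L1 = vec.span {v1}" using L(1) by (auto simp: in_PP)
    obtain v2 where v2: "v2 \<noteq> 0" "L2 = vec.span {v2}" using L(4) by (auto simp: in_PP)
    obtain g1 where g1: "g1 \<in> S1" "g1 v1 \<noteq> 0" using L(3) in_zero_locus[OF v1(1) S1(1)[rule_format]] S1(2) v1 by auto
    obtain g2 where g2: "g2 \<in> S2" "g2 v2 \<noteq> 0" using L(6) in_zero_locus[OF v2(1) S2(1)[rule_format]] S2(2) v2 by auto
    have vU: "v1 \<in> U" "v2 \<in> U" using L v1 v2 vec.span_base by blast+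
    obtain k where k: "v1 $ k \<noteq> 0" using v1(1) by (metis vec_eq_iff zero_index)
    obtain d1 where "homogeneous d1 g1" using S1(1) g1(1) by blast
    then obtain p1 where p1: "\<forall>t. g1 (v1 + t *s (v2 - v1)) = poly p1 t" by (rule homogeneous_on_line)
    obtain d2 where "homogeneous d2 g2" using S2(1) g2(1) by blast
    then obtain p2 where p2: "\<forall>t. g2 (v1 + t *s (v2 - v1)) = poly p2 t" by (rule homogeneous_on_line)
    \<comment> \<open>The third factor keeps a coordinate nonzero, so that a non-root gives a point of projective space.\<close>
    define p where "p = p1 * p2 * [:v1 $ k, v2 $ k - v1 $ k:]"
    have "p1 \<noteq> 0" using p1[rule_format, of 0] g1(2) by auto
    moreover have "p2 \<noteq> 0" using p2[rule_format, of 1] g2(2) by auto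
    moreover have "[:v1 $ k, v2 $ k - v1 $ k:] \<noteq> 0" using k by simp
    ultimately have "p \<noteq> 0" unfolding p_def by (metis mult_eq_0_iff)
    then have "finite {t. poly p t = 0}" by (rule poly_roots_finite)
    then obtain t where t: "poly p t \<noteq> 0"
      using ex_new_if_finite[OF infinite_UNIV_char_0] by auto
    define v where "v = v1 + t *s (v2 - v1)"
    have t': "poly p1 t \<noteq> 0" "poly p2 t \<noteq> 0" "poly [:v1 $ k, v2 $ k - v1 $ k:] t \<noteq> 0"
      using t unfolding p_def poly_mult by auto
    have "v $ k \<noteq> 0" using t'(3) by (simp add: v_def algebra_simps)
    then have v: "v \<noteq> 0" "g1 v \<noteq> 0" "g2 v \<noteq> 0"
      using t'(1,2) p1 p2 by (auto simp only: v_def zero_index)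
    have "v \<in> U" unfolding v_def
      using U vU by (intro vec.subspace_add vec.subspace_scale vec.subspace_diff)
    then have "vec.span {v} \<in> Z1 \<union> Z2"
      using cover sub v(1) by (auto simp: in_PP)
    then show False
      using in_zero_locus[OF v(1) S1(1)[rule_format]] in_zero_locus[OF v(1) S2(1)[rule_format]] S1(2) S2(2) v g1 g2 by auto
  qed
qed

section \<open>Invariance under the group\<close>

lemma cubic_polar_expand: "cubic_polar u v z = (\<Sum>k\<in>UNIV. u $ k * cubic_polar (axis k 1) v z)"
proof -
  have "cubic_polar u v z = cubic_polar (\<Sum>k\<in>UNIV. u $ k *s axis k 1) v z"
    by (simp add: basis_expansion)
  then show ?thesis by (simp add: cubic_polar_sum cubic_polar_linear)
qed

lemma cubic_polar_expand3:
  "cubic_polar u v z = (\<Sum>i\<in>UNIV. \<Sum>j\<in>UNIV. \<Sum>k\<in>UNIV.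
     u $ i * (v $ j * (z $ k * cubic_polar (axis i 1) (axis j 1) (axis k 1))))"
proof -
  have 2: "cubic_polar x v z = (\<Sum>j\<in>UNIV. v $ j * cubic_polar x (axis j 1) z)" for x v z
    using cubic_polar_expand[of v x z] by (simp add: cubic_polar_commute[of x])
  have 3: "cubic_polar x y z = (\<Sum>k\<in>UNIV. z $ k * cubic_polar x y (axis k 1))" for x y z
    using cubic_polar_expand[of z x y] by (simp add: cubic_polar_rotate[of _ x y])
  show ?thesis
    by (subst cubic_polar_expand, subst 2, subst 3) (simp add: sum_distrib_left)
qed

lemma cubic_polar_deriv:
  assumes "\<And>k. ((\<lambda>t. x t $ k) has_field_derivative x' $ k) (at t)"
    "\<And>k. ((\<lambda>t. y t $ k) has_field_derivative y' $ k) (at t)"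
    "\<And>k. ((\<lambda>t. z t $ k) has_field_derivative z' $ k) (at t)"
  shows "((\<lambda>t. cubic_polar (x t) (y t) (z t)) has_field_derivative
     cubic_polar x' (y t) (z t) + cubic_polar (x t) y' (z t) + cubic_polar (x t) (y t) z') (at t)"
proof -
  have "((\<lambda>t. \<Sum>i\<in>UNIV. \<Sum>j\<in>UNIV. \<Sum>k\<in>UNIV.
     x t $ i * (y t $ j * (z t $ k * cubic_polar (axis i 1) (axis j 1) (axis k 1)))) has_field_derivative
     (\<Sum>i\<in>UNIV. \<Sum>j\<in>UNIV. \<Sum>k\<in>UNIV.
       x' $ i * (y t $ j * (z t $ k * cubic_polar (axis i 1) (axis j 1) (axis k 1)))
     + x t $ i * (y' $ j * (z t $ k * cubic_polar (axis i 1) (axis j 1) (axis k 1)))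
     + x t $ i * (y t $ j * (z' $ k * cubic_polar (axis i 1) (axis j 1) (axis k 1))))) (at t)"
    by (intro DERIV_sum) (auto intro!: derivative_eq_intros assms simp: algebra_simps)
  then show ?thesis
    unfolding cubic_polar_expand3[of "x t" "y t" "z t" for t] cubic_polar_expand3[of x'] cubic_polar_expand3[of _ y']
      cubic_polar_expand3[of _ _ z'] sum.distrib .
qed

abbreviation g6 :: "cmat set" where
  "g6 \<equiv> lie_algebra (e6 ` {1..6} \<union> f6 ` {1..6} \<union> h6 ` {1..6})"

abbreviation G6 :: "cmat set" where
  "G6 \<equiv> E6_group e6 f6 h6"

lemma annihilates_g6: "M \<in> g6 \<Longrightarrow> annihilates M"
proof (erule annihilates_lie_algebra)
  fix M assume M: "M \<in> e6 ` {1..6} \<union> f6 ` {1..6} \<union> h6 ` {1..6}"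
  let ?S = "e6 ` {1..6} \<union> f6 ` {1..6}"
  have S: "annihilates N" if "N \<in> ?S" for N using that annihilates_e annihilates_f by auto
  have "M \<in> lie_algebra ?S"
  proof (cases "M \<in> ?S")
    case False
    then obtain i where i: "i \<in> {1..6}" "M = h6 i" using M by auto
    then have "M = bracket (e6 i) (f6 i)" using bracket_e_f_same by simp
    moreover have "e6 i \<in> ?S" "f6 i \<in> ?S" using i(1) by blast+
    ultimately show ?thesis by (simp only: lie_algebra.bracket lie_algebra.generator)
  qed (rule lie_algebra.generator)
  then show "annihilates M" using S by (rule annihilates_lie_algebra)
qed

text \<open>
  Along the flow of an element of the Lie algebra the derivative of the trilinear form is the expression in
  the definition of \<open>annihilates\<close>.
\<close>

lemma cubic_polar_invariant:
  assumes "g \<in> G6"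
  shows "cubic_polar (g *v x) (g *v y) (g *v z) = cubic_polar x y z"
  using assms unfolding E6_group_def
proof induct
  case (mult M N)
  let ?x = "\<lambda>v t. mat_exp (mat t ** M) *v (N *v v)"
  let ?c = "\<lambda>t. cubic_polar (?x x t) (?x y t) (?x z t)"
  have "(?c has_field_derivative 0) (at t)" for t
  proof -
    have "(?c has_field_derivative
       cubic_polar (M *v ?x x t) (?x y t) (?x z t) + cubic_polar (?x x t) (M *v ?x y t) (?x z t)
       + cubic_polar (?x x t) (?x y t) (M *v ?x z t)) (at t)"
      by (intro cubic_polar_deriv flow_deriv)
    then show ?thesis
      using annihilates_g6[OF mult(1)] by (simp add: annihilates_def)
  qed
  then have "?c 1 = ?c 0" by (rule constant_if_deriv_zero)
  then show ?case by (simp add: matrix_vector_mul_assoc[symmetric] mult)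
qed simp

lemma G6_mult: "g \<in> G6 \<Longrightarrow> g' \<in> G6 \<Longrightarrow> g ** g' \<in> G6"
  unfolding E6_group_def by (rule exp_group_mult)

lemma G6_one: "mat 1 \<in> G6"
  unfolding E6_group_def by (rule exp_group.one)

lemma G6_exp: "M \<in> g6 \<Longrightarrow> mat_exp M \<in> G6"
  unfolding E6_group_def by (rule mat_exp_in_group)

lemma G6_inverse:
  assumes "g \<in> G6" obtains g' where "g' \<in> G6" "\<And>v. g' *v (g *v v) = v" "\<And>v. g *v (g' *v v) = v"
proof -
  obtain g' where "g' \<in> G6" "g' ** g = mat 1" "g ** g' = mat 1"
    using assms unfolding E6_group_def by (rule exp_group_inverse)
  then show thesis by (intro that[of g']) (simp_all add: matrix_vector_mul_assoc)
qed

lemma G6_nonzero: "g \<in> G6 \<Longrightarrow> v \<noteq> 0 \<Longrightarrow> g *v v \<noteq> 0"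
  by (metis G6_inverse matrix_vector_mult_0_right)

lemma act_span: "act g (vec.span {v}) = vec.span {g *v v}"
  unfolding act_def span_point by (auto simp: image_iff vector_scalar_commute) (metis vector_scalar_commute)

lemma act_act: "act g (act g' L) = act (g ** g') L"
  unfolding act_def by (simp add: image_image matrix_vector_mul_assoc)

lemma act_one: "act (mat 1) L = L"
  by (simp add: act_def)

lemma homogeneous_cubic: "homogeneous 3 F_C"
proof -
  have eq: "F_C = (\<lambda>v. \<Sum>i\<in>UNIV. \<Sum>j\<in>UNIV. \<Sum>k\<in>UNIV.
     v $ i * (v $ j * (v $ k * (1 / 6 * cubic_polar (axis i 1) (axis j 1) (axis k 1) * 1))))"
  proof
    fix v
    have "F_C v = 1 / 6 * cubic_polar v v v" by (simp add: cubic_polar_diag)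
    then show "F_C v = (\<Sum>i\<in>UNIV. \<Sum>j\<in>UNIV. \<Sum>k\<in>UNIV.
     v $ i * (v $ j * (v $ k * (1 / 6 * cubic_polar (axis i 1) (axis j 1) (axis k 1) * 1))))"
      unfolding cubic_polar_expand3[of v v v] by (simp add: sum_distrib_left mult_ac)
  qed
  show ?thesis
    unfolding numeral_3_eq_3
    by (subst eq) (intro homogeneous_sum homogeneous_coord_mult homogeneous_scale homogeneous_one)
qed

lemma homogeneous_partial: "homogeneous 2 (partial k F_C)"
proof -
  have eq: "partial k F_C = (\<lambda>v. \<Sum>i\<in>UNIV. \<Sum>j\<in>UNIV.
     v $ i * (v $ j * (1 / 2 * cubic_polar (axis i 1) (axis j 1) (axis k 1) * 1)))"
  proof
    fix v
    have "cubic_polar v v (axis k 1) = (\<Sum>i\<in>UNIV. v $ i * (\<Sum>j\<in>UNIV. v $ j * cubic_polar (axis i 1) (axis j 1) (axis k 1)))"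
      by (subst cubic_polar_expand, subst cubic_polar_commute, subst cubic_polar_expand)
         (simp add: cubic_polar_commute)
    then show "partial k F_C v = (\<Sum>i\<in>UNIV. \<Sum>j\<in>UNIV.
     v $ i * (v $ j * (1 / 2 * cubic_polar (axis i 1) (axis j 1) (axis k 1) * 1)))"
      by (simp add: partial_F_C sum_distrib_left sum_divide_distrib mult_ac)
  qed
  show ?thesis
    unfolding numeral_2_eq_2
    by (subst eq) (intro homogeneous_sum homogeneous_coord_mult homogeneous_scale homogeneous_one)
qed

lemma F_C_invariant: "g \<in> G6 \<Longrightarrow> F_C (g *v v) = F_C v"
  using cubic_polar_invariant[of g v v v] by (simp add: cubic_polar_diag)

lemma in_V_F_C: "v \<noteq> 0 \<Longrightarrow> vec.span {v} \<in> V F_C \<longleftrightarrow> F_C v = 0"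
  by (subst in_zero_locus) (use homogeneous_cubic in auto)

lemma invariant_surj:
  assumes "\<And>g L. g \<in> G6 \<Longrightarrow> L \<in> Z \<Longrightarrow> act g L \<in> Z" "g \<in> G6"
  shows "act g ` Z = Z"
proof
  show "act g ` Z \<subseteq> Z" using assms by auto
  obtain g' where g': "g' \<in> G6" "\<And>v. g *v (g' *v v) = v" using G6_inverse[OF assms(2)] by metis
  show "Z \<subseteq> act g ` Z"
  proof
    fix L assume L: "L \<in> Z"
    have "act g (act g' L) = L" unfolding act_def using g'(2) by (simp add: image_image)
    then show "L \<in> act g ` Z" using assms(1)[OF g'(1) L] by (metis imageI)
  qed
qed

lemma Cartan_cubic: "is_Cartan_cubic G6 (V F_C)"
  unfolding is_Cartan_cubic_def cubic_hypersurface_def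
proof (intro conjI ballI)
  have "F_C (unit (La 1) + unit (Lb 1) + unit Lw) = - 1"
    by (simp add: F_C_def F_def q_def q'_def Pf_def pfaffian4_def sum_5 P_entry_def skip_def)
  then have "\<exists>v. F_C v \<noteq> 0" by (metis neg_equal_0_iff_equal zero_neq_one)
  then show "\<exists>f. homogeneous 3 f \<and> (\<exists>v. f v \<noteq> 0) \<and> V F_C = V f"
    using homogeneous_cubic by blast
  fix g assume g: "g \<in> G6"
  show "act g ` V F_C = V F_C"
  proof (rule invariant_surj[OF _ g])
    fix g L assume g: "g \<in> G6" and L: "L \<in> V F_C"
    then obtain v where v: "v \<noteq> 0" "L = vec.span {v}" by (auto simp: zero_locus_def in_PP)
    then show "act g L \<in> V F_C"
      using L g by (simp add: act_span in_V_F_C G6_nonzero F_C_invariant)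
  qed
qed

section \<open>The Cayley plane as an orbit\<close>

text \<open>
  The singular locus of the cubic hypersurface.  In this form the set is closed by definition, and invariant
  because the cubic is.
\<close>

definition cayley :: "point set" where
  "cayley = zero_locus (range (\<lambda>k. partial k F_C))"

lemma closed_cayley: "zariski_closed cayley"
  unfolding zariski_closed_def cayley_def
  by (intro exI[of _ "range (\<lambda>k. partial k F_C)"]) (use homogeneous_partial in auto)

lemma in_cayley:
  assumes "v \<noteq> 0" shows "vec.span {v} \<in> cayley \<longleftrightarrow> (\<forall>u. cubic_polar v v u = 0)"
proof -
  have "vec.span {v} \<in> cayley \<longleftrightarrow> (\<forall>k. cubic_polar v v (axis k 1) = 0)"
    unfolding cayley_def
    by (subst in_zero_locus[OF assms]) (use homogeneous_partial in \<open>auto simp: partial_F_C\<close>)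
  also have "\<dots> \<longleftrightarrow> (\<forall>u. cubic_polar v v u = 0)"
  proof (intro iffI allI)
    fix u assume "\<forall>k. cubic_polar v v (axis k 1) = 0"
    then have "cubic_polar (axis k 1) v v = 0" for k using cubic_polar_rotate by metis
    then have "cubic_polar u v v = 0" by (subst cubic_polar_expand) simp
    then show "cubic_polar v v u = 0" using cubic_polar_rotate by metis
  qed simp
  finally show ?thesis .
qed

lemma gradient_invariant:
  assumes "g \<in> G6" "\<forall>u. cubic_polar v v u = 0" shows "\<forall>u. cubic_polar (g *v v) (g *v v) u = 0"
  using assms by (metis G6_inverse cubic_polar_invariant)

text \<open>
  Away from \<open>w = 0\<close>, vanishing of the derivatives by \<open>a\<close> and \<open>b\<close> determines the vector from \<open>w\<close> and the
  spinor.
\<close>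

lemma gradient_La: "i \<in> {1..5} \<Longrightarrow> cubic_polar v v (unit (La i)) = 2 * (q i v - var (Lb i) v * var Lw v)"
proof -
  assume "i \<in> {1..5}"
  then have "i = 1 \<or> i = 2 \<or> i = 3 \<or> i = 4 \<or> i = 5" by auto
  then show ?thesis
    by (elim disjE) (simp_all add: cubic_evaluation q_def q'_def Pf_def pfaffian4_def)
qed

lemma gradient_Lb: "i \<in> {1..5} \<Longrightarrow> cubic_polar v v (unit (Lb i)) = 2 * (q' i v - var (La i) v * var Lw v)"
proof -
  assume "i \<in> {1..5}"
  then have "i = 1 \<or> i = 2 \<or> i = 3 \<or> i = 4 \<or> i = 5" by auto
  then show ?thesis
    by (elim disjE) (simp_all add: cubic_evaluation q_def q'_def Pf_def pfaffian4_def)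
qed

text \<open>Every monomial of \<open>F_C\<close> is a product of three different variables.\<close>

lemma unit_singular: "cubic_polar (axis k 1) (axis k 1) u = 0"
proof -
  have "\<forall>l\<in>labels. cubic_polar (unit l) (unit l) u = 0"
    unfolding labels_eq by (simp add: cubic_evaluation)
  then have "\<forall>k. cubic_polar (axis k 1) (axis k 1) u = 0" unfolding all_coord .
  then show ?thesis ..
qed

lemma nilradical_eq_0:
  assumes "\<forall>l\<in>spinor_labels. var l s = 0" shows "nilradical s = 0"
  using assms unfolding matrix_eq_labels labels_eq spinor_labels_eq
  by (simp add: nilradical_comp_def q_polar_def q'_polar_def Pf_polar_def two_Suc sum_5 skip_def P_entry_def)

lemma nilradical_vector: "\<forall>l\<in>labels - spinor_labels. nilradical (unit l) = 0"
  by (intro ballI nilradical_eq_0) (auto simp: labels_decomp)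

text \<open>
  The spinors whose operators lie in the Lie algebra form a subspace that contains \<open>x0\<close>, since
  \<open>nilradical (unit Lx0)\<close> is the generator \<open>f6 1\<close>, and that is closed under the lowering operators of
  \<open>so(10)\<close>; so it contains all spinors.
\<close>

lemma nilradical_in_g6: "nilradical s \<in> g6"
proof -
  let ?U = "{s. nilradical s \<in> g6}"
  have U: "vec.subspace ?U"
    unfolding vec.subspace_def
  proof (intro conjI ballI allI)
    have "nilradical (0 *s 0) = mat 0 ** nilradical 0" by (rule nilradical_linear)
    then show "0 \<in> ?U" by (simp add: lie_algebra.zero)
  qed (simp_all add: nilradical_linear lie_algebra.add lie_algebra.scale)
  have "\<forall>l\<in>spinor_labels. unit l \<in> ?U"
  proof (rule spinors_from_x0[OF U])
    fix i v assume i: "i \<in> {2..6::nat}" and v: "v \<in> ?U"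
    then have "nilradical (f6 i *v v) = bracket (f6 i) (nilradical v)" using bracket_f_nilradical by auto
    moreover have "f6 i \<in> g6" using i by (intro lie_algebra.generator) auto
    ultimately show "f6 i *v v \<in> ?U" using v by (simp add: lie_algebra.bracket)
  next
    have "f6 1 \<in> g6" by (intro lie_algebra.generator) auto
    then show "unit Lx0 \<in> ?U" by (simp add: nilradical_x0)
  qed
  moreover have "\<forall>l\<in>labels - spinor_labels. unit l \<in> ?U"
    using nilradical_vector by (simp add: lie_algebra.zero)
  ultimately have "\<forall>l\<in>labels. unit l \<in> ?U" by blast
  then have "\<forall>k. axis k 1 \<in> ?U" unfolding all_coord .
  then have "(\<Sum>k\<in>UNIV. s $ k *s axis k 1) \<in> ?U"
    by (intro vec.subspace_sum[OF U] vec.subspace_scale[OF U]) blast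
  then show ?thesis by (simp add: basis_expansion)
qed

text \<open>
  Along the flow the coordinate \<open>w\<close> stays constant, and hence the spinor coordinates grow linearly.
\<close>

lemma nilradical_exp:
  assumes "l \<in> spinor_labels"
  shows "var Lw (mat_exp (nilradical s) *v unit Lw) = 1" "var l (mat_exp (nilradical s) *v unit Lw) = var l s"
proof -
  have l: "l \<in> labels" "l \<noteq> Lw" using assms by (auto simp: labels_decomp spinor_labels_def)
  let ?x = "\<lambda>t. mat_exp (mat t ** nilradical s) *v unit Lw"
  have D: "((\<lambda>t. var l (?x t)) has_field_derivative var l (nilradical s *v ?x t)) (at t)" for l t
    unfolding var_def by (rule flow_deriv)
  have "((\<lambda>t. var Lw (?x t)) has_field_derivative 0) (at t)" for t
    using D[of Lw t] by (simp add: nilradical_comp_def)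
  then have w: "var Lw (?x t) = var Lw (?x 0)" for t by (rule constant_if_deriv_zero)
  then have w: "var Lw (?x t) = 1" for t by simp
  then show "var Lw (mat_exp (nilradical s) *v unit Lw) = 1" using w[of 1] by simp
  have "((\<lambda>t. var l (?x t)) has_field_derivative var l s) (at t)" for t
    using D[of l t] assms l(1) w[of t] by (auto simp: nilradical_comp_def spinor_labels_def)
  then have "((\<lambda>t. var l (?x t) - t * var l s) has_field_derivative 0) (at t)" for t
    by (auto intro!: derivative_eq_intros)
  then have "var l (?x 1) - 1 * var l s = var l (?x 0) - 0 * var l s" by (rule constant_if_deriv_zero)
  then show "var l (mat_exp (nilradical s) *v unit Lw) = var l s" using l by simp
qed

lemma q_cong: "(\<And>l. l \<in> spinor_labels \<Longrightarrow> var l u = var l v) \<Longrightarrow> i \<in> {1..5} \<Longrightarrow> q i u = q i v \<and> q' i u = q' i v"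
proof -
  assume *: "\<And>l. l \<in> spinor_labels \<Longrightarrow> var l u = var l v" and "i \<in> {1..5}"
  then have "i = 1 \<or> i = 2 \<or> i = 3 \<or> i = 4 \<or> i = 5" by auto
  then show ?thesis
    by (elim disjE) (simp_all add: * spinor_labels_eq q_def q'_def Pf_def pfaffian4_def sum_5 skip_def P_entry_def)
qed

text \<open>
  Both sides are singular points of the cubic with the same \<open>w = 1\<close> and the same spinor part, and these
  data determine the vector part.
\<close>

lemma big_cell:
  assumes u: "\<forall>z. cubic_polar u u z = 0" and w: "var Lw u = 1"
  shows "u = mat_exp (nilradical u) *v unit Lw"
proof (rule cvec_eqI)
  let ?x = "mat_exp (nilradical u) *v unit Lw"
  have x: "\<forall>z. cubic_polar ?x ?x z = 0"
    by (rule gradient_invariant[OF G6_exp[OF nilradical_in_g6]]) (simp add: unit_singular)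
  have s: "var l ?x = var l u" if "l \<in> spinor_labels" for l using nilradical_exp(2)[OF that] .
  have xw: "var Lw ?x = 1" using nilradical_exp(1)[of Lx0] by (simp add: spinor_labels_eq)
  have ab: "var (Lb i) v = q i v \<and> var (La i) v = q' i v"
    if "\<forall>z. cubic_polar v v z = 0" "var Lw v = 1" "i \<in> {1..5}" for v i
    using gradient_La[OF that(3), of v] gradient_Lb[OF that(3), of v] that(1,2) by simp
  fix l assume "l \<in> labels"
  then consider "l \<in> spinor_labels" | i where "i \<in> {1..5}" "l = La i \<or> l = Lb i" | "l = Lw"
    unfolding labels_decomp by blast
  then show "var l u = var l ?x"
  proof cases
    case 2
    then show ?thesis using ab[OF u w 2(1)] ab[OF x xw 2(1)] q_cong[OF s 2(1)] by auto
  qed (simp_all add: s w xw)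
qed

text \<open>
  The vectors whose whole orbit lies in \<open>w = 0\<close> form a subspace.  It is invariant under the Lie algebra, as
  is seen by differentiating \<open>g exp (t M) u\<close> at \<open>t = 0\<close>, so irreducibility applies.
\<close>

lemma nonzero_Lw_in_orbit:
  assumes "v \<noteq> 0" obtains g where "g \<in> G6" "var Lw (g *v v) \<noteq> 0"
proof -
  let ?U = "{u. \<forall>g\<in>G6. var Lw (g *v u) = 0}"
  have U: "vec.subspace ?U"
    unfolding vec.subspace_def by (simp add: matrix_vector_right_distrib vector_scalar_commute)
  have closed: "M *v u \<in> ?U" if M: "M \<in> g6" and u: "u \<in> ?U" for M u
  proof (intro CollectI ballI)
    fix g assume g: "g \<in> G6"
    let ?p = "\<lambda>t. \<Sum>j\<in>UNIV. g $ Abs_coord Lw $ j * (mat_exp (mat t ** M) *v u) $ j"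
    have p: "?p t = var Lw ((g ** mat_exp (mat t ** M)) *v u)" for t
      by (simp add: matrix_vector_mul_assoc[symmetric] var_def) (simp add: matrix_vector_mult_def)
    have "g ** mat_exp (mat t ** M) \<in> G6" for t
      by (intro G6_mult g G6_exp lie_algebra.scale M)
    then have "?p = (\<lambda>t. 0)" using u unfolding p by auto
    moreover have "(?p has_field_derivative
      (\<Sum>j\<in>UNIV. g $ Abs_coord Lw $ j * (M *v (mat_exp (mat 0 ** M) *v u)) $ j)) (at 0)"
      by (intro DERIV_sum DERIV_cmult flow_deriv)
    ultimately have "(\<Sum>j\<in>UNIV. g $ Abs_coord Lw $ j * (M *v (mat_exp (mat 0 ** M) *v u)) $ j) = 0"
      by (metis DERIV_const DERIV_unique)
    then show "var Lw (g *v (M *v u)) = 0"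
      by (simp add: var_def) (simp add: matrix_vector_mult_def)
  qed
  have "?U = {0} \<or> ?U = UNIV"
    by (rule rep_irreducible[OF U]) (auto intro!: closed[THEN CollectD, THEN bspec] lie_algebra.generator)
  moreover have "unit Lw \<notin> ?U" using G6_one by force
  ultimately have "v \<notin> ?U" using assms by auto
  then show thesis using that by auto
qed

definition orbit :: "point \<Rightarrow> point set" where
  "orbit L = {act g L | g. g \<in> G6}"

lemma orbit_eq:
  assumes "L' \<in> orbit L" shows "orbit L' = orbit L"
proof -
  have sub: "orbit L' \<subseteq> orbit L" if "L' \<in> orbit L" for L L'
    using that unfolding orbit_def by (auto simp: act_act intro: G6_mult)
  obtain g where g: "g \<in> G6" "L' = act g L" using assms by (auto simp: orbit_def)
  obtain g' where g': "g' \<in> G6" "\<And>v. g' *v (g *v v) = v" using G6_inverse[OF g(1)] by metis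
  then have "L = act g' L'" by (simp add: g act_def image_image)
  then have "L \<in> orbit L'" using g'(1) by (auto simp: orbit_def)
  then show ?thesis using sub assms by blast
qed

text \<open>
  A singular point is moved into the chart \<open>w \<noteq> 0\<close>; there it is the image of the point
  \<open>w\<close> under the exponential of an element of the nilradical.
\<close>

lemma cayley_orbit: "cayley = orbit (vec.span {unit Lw})"
proof
  show "orbit (vec.span {unit Lw}) \<subseteq> cayley"
    unfolding orbit_def
    by (auto simp: act_span in_cayley G6_nonzero axis_eq_0_iff unit_singular gradient_invariant)
  show "cayley \<subseteq> orbit (vec.span {unit Lw})"
  proof
    fix L assume L: "L \<in> cayley"
    then obtain v where v: "v \<noteq> 0" "L = vec.span {v}" by (auto simp: cayley_def zero_locus_def in_PP)
    have v0: "\<forall>u. cubic_polar v v u = 0" using L v in_cayley by auto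
    obtain g where g: "g \<in> G6" "var Lw (g *v v) \<noteq> 0" using v(1) by (rule nonzero_Lw_in_orbit)
    obtain g' where g': "g' \<in> G6" "\<And>v. g' *v (g *v v) = v" using G6_inverse[OF g(1)] by metis
    define c where "c = 1 / var Lw (g *v v)"
    let ?u = "c *s (g *v v)"
    have c: "c \<noteq> 0" using g(2) by (simp add: c_def)
    have "?u = mat_exp (nilradical ?u) *v unit Lw"
      using gradient_invariant[OF g(1) v0] g(2) by (intro big_cell) (simp_all add: cubic_polar_linear c_def)
    then have "g' *v ?u = (g' ** mat_exp (nilradical ?u)) *v unit Lw"
      by (metis matrix_vector_mul_assoc)
    then have "c *s v = (g' ** mat_exp (nilradical ?u)) *v unit Lw"
      by (simp add: vector_scalar_commute g')
    then have "L = act (g' ** mat_exp (nilradical ?u)) (vec.span {unit Lw})"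
      by (metis act_span span_scale[OF c] v(2))
    then show "L \<in> orbit (vec.span {unit Lw})"
      unfolding orbit_def using G6_mult[OF g'(1) G6_exp[OF nilradical_in_g6]] by blast
  qed
qed

section \<open>Uniqueness of the closed orbit\<close>

lemma gen_h_in_g6: "gen_h \<in> g6"
proof -
  have "h6 i \<in> g6" if "i \<in> {1..6}" for i using that by (intro lie_algebra.generator) auto
  then show ?thesis
    unfolding gen_h_eq by (intro lie_algebra.add lie_algebra.scale) auto
qed

lemma mat_diag: "mat c ** diag d = diag (\<lambda>k. c * d k)"
  by (simp add: matrix_eq vec_eq_iff)

text \<open>
  The generic one-parameter subgroup of the torus contracts a point, after rescaling, to the coordinate of
  largest weight among its nonzero coordinates.  The limit stays in the closed set, and every coordinate
  point is singular.
\<close>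

lemma closed_invariant_meets_cayley:
  assumes Z: "zariski_closed Z" and L: "L \<in> Z" and inv: "\<And>g. g \<in> G6 \<Longrightarrow> act g L \<in> Z"
  shows "Z \<inter> cayley \<noteq> {}"
proof -
  obtain S where S: "\<forall>g\<in>S. \<exists>d. homogeneous d g" "Z = zero_locus S"
    using Z by (rule zariski_closedE)
  obtain v where v: "v \<noteq> 0" "L = vec.span {v}" using L S(2) by (auto simp: zero_locus_def in_PP)
  let ?d = "\<lambda>k. gen_wt (Rep_coord k)"
  let ?K = "{k. v $ k \<noteq> 0}"
  have "?K \<noteq> {}" using v(1) by (auto simp: vec_eq_iff)
  then have "Max (?d ` ?K) \<in> ?d ` ?K" by (intro Max_in) auto
  then obtain k where k: "Max (?d ` ?K) = ?d k" "k \<in> ?K" by (rule imageE)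
  have le: "?d j \<le> ?d k" if "v $ j \<noteq> 0" for j
    unfolding k(1)[symmetric] using that by (intro Max_ge) auto
  have lt: "?d j < ?d k" if "v $ j \<noteq> 0" "j \<noteq> k" for j
  proof -
    have "?d j \<noteq> ?d k" using that(2) inj_gen_wt Rep_coord Rep_coord_inject by (metis inj_onD)
    then show ?thesis using le[OF that(1)] by simp
  qed
  \<comment> \<open>The image of \<open>v\<close> under \<open>exp (n gen_h)\<close>, divided by the factor at coordinate \<open>k\<close>.\<close>
  define x where "x n = (\<chi> j. exp (of_int (?d j - ?d k)) ^ n * v $ j)" for n
  have x: "x n = exp (- of_nat n * of_int (?d k)) *s (mat_exp (mat (of_nat n) ** gen_h) *v v)" for n
  proof -
    have "exp (of_int (?d j - ?d k)) ^ n
        = exp (- of_nat n * of_int (?d k)) * exp (of_nat n * of_int (?d j) :: complex)" for j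
      unfolding exp_of_nat_mult[symmetric] exp_add[symmetric] by (simp add: algebra_simps)
    then show ?thesis
      unfolding gen_h_def mat_diag diag_exp x_def by (simp add: vec_eq_iff)
  qed
  have "x \<longlonglongrightarrow> v $ k *s axis k 1"
  proof (rule vec_tendstoI)
    fix j
    show "(\<lambda>n. x n $ j) \<longlonglongrightarrow> (v $ k *s axis k 1) $ j"
    proof (cases "j = k \<or> v $ j = 0")
      case True
      then show ?thesis by (auto simp: x_def axis_def)
    next
      case False
      have "norm (exp (of_int (?d j - ?d k)) :: complex) < 1"
        using lt[of j] False by (simp add: norm_exp_eq_Re)
      then have "(\<lambda>n. exp (of_int (?d j - ?d k)) ^ n * v $ j) \<longlonglongrightarrow> 0 * v $ j"
        by (intro tendsto_mult LIMSEQ_power_zero tendsto_const)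
      then show ?thesis using False by (simp add: x_def axis_def)
    qed
  qed
  have "g (v $ k *s axis k 1) = 0" if g: "g \<in> S" for g
  proof -
    obtain d where d: "homogeneous d g" using S(1) g by blast
    have "g (x n) = 0" for n
    proof -
      let ?e = "mat_exp (mat (of_nat n) ** gen_h)"
      have e: "?e \<in> G6" by (intro G6_exp lie_algebra.scale gen_h_in_g6)
      have "vec.span {?e *v v} \<in> zero_locus S" using inv[OF e] S(2) v(2) by (simp add: act_span)
      then have "g (?e *v v) = 0"
        using in_zero_locus[OF G6_nonzero[OF e v(1)] S(1)[rule_format]] g by blast
      then show ?thesis unfolding x homogeneous_cmul[OF d] by simp
    qed
    moreover have "(\<lambda>n. g (x n)) \<longlonglongrightarrow> g (v $ k *s axis k 1)"
      using homogeneous_continuous[OF d] \<open>x \<longlonglongrightarrow> _\<close>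
      by (simp add: continuous_on_eq_continuous_at isCont_tendsto_compose)
    ultimately show ?thesis by (simp add: LIMSEQ_const_iff)
  qed
  moreover have ne: "v $ k *s axis k 1 \<noteq> (0 :: cvec)" using k(2) by (simp add: axis_eq_0_iff)
  ultimately have "vec.span {v $ k *s axis k 1} \<in> Z"
    unfolding S(2) by (subst in_zero_locus[OF ne]) (use S(1) in auto)
  moreover have "vec.span {v $ k *s axis k 1} \<in> cayley"
    unfolding in_cayley[OF ne] by (simp add: cubic_polar_linear unit_singular)
  ultimately show ?thesis by blast
qed

text \<open>Any other closed orbit would meet the Cayley plane, which is itself an orbit.\<close>

lemma cayley_plane: "is_Cayley_plane G6 cayley"
  unfolding is_Cayley_plane_def
proof (intro equalityI subsetI)
  have orb: "orbits G6 = {orbit L | L. L \<in> PP}" by (simp add: orbits_def orbit_def)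
  have "unit Lw \<noteq> (0 :: cvec)" by (simp add: axis_eq_0_iff)
  then have "vec.span {unit Lw} \<in> PP" unfolding in_PP by blast
  then have "cayley \<in> orbits G6" unfolding orb cayley_orbit by blast
  then show "Z \<in> {Z' \<in> orbits G6. zariski_closed Z'}" if "Z \<in> {cayley}" for Z
    using that closed_cayley by simp
  fix Z assume "Z \<in> {Z' \<in> orbits G6. zariski_closed Z'}"
  then obtain L where L: "Z = orbit L" and Z: "zariski_closed Z" unfolding orb by blast
  have "L \<in> Z" unfolding L orbit_def using G6_one act_one by (metis (mono_tags, lifting) mem_Collect_eq)
  moreover have "act g L \<in> Z" if "g \<in> G6" for g unfolding L orbit_def using that by blast
  ultimately obtain L' where "L' \<in> Z" "L' \<in> cayley"
    using closed_invariant_meets_cayley[OF Z] by blast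
  then have "Z = cayley" unfolding L cayley_orbit using orbit_eq by metis
  then show "Z \<in> {cayley}" by simp
qed

section \<open>The singular locus of the hyperplane section\<close>

text \<open>
  The sixteen equations say that the spinor \<open>(x0, x, y)\<close> is killed by Clifford multiplication with the
  vector \<open>(a, b)\<close>.  Multiplying once more by the vector multiplies the spinor by the quadratic form
  \<open>\<Sum>i. a i * b i\<close>, so the spinor vanishes if the form does not.  The components are treated
  in the order \<open>x0\<close>, \<open>y\<close>, \<open>x\<close>, each time contracting some of the equations with \<open>a\<close> or \<open>b\<close>.  Each
  equation carries the name of the variable by which the cubic form is differentiated in it.
\<close>

lemma clifford_kernel:
  fixes x0 x12 x13 x14 x15 x23 x24 x25 x34 x35 x45 y1 y2 y3 y4 y5 a1 a2 a3 a4 a5 b1 b2 b3 b4 b5 :: complex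
  assumes x0: "y1 * a1 + y2 * a2 + y3 * a3 + y4 * a4 + y5 * a5 = 0"
    and y1: "x0 * a1 + x12 * b2 + x13 * b3 + x14 * b4 + x15 * b5 = 0"
    and y2: "x0 * a2 - x12 * b1 + x23 * b3 + x24 * b4 + x25 * b5 = 0"
    and y3: "x0 * a3 - x13 * b1 - x23 * b2 + x34 * b4 + x35 * b5 = 0"
    and y4: "x0 * a4 - x14 * b1 - x24 * b2 - x34 * b3 + x45 * b5 = 0"
    and y5: "x0 * a5 - x15 * b1 - x25 * b2 - x35 * b3 - x45 * b4 = 0"
    and x12: "y1 * b2 - y2 * b1 + x45 * a3 - x35 * a4 + x34 * a5 = 0"
    and x13: "y1 * b3 - y3 * b1 - x45 * a2 + x25 * a4 - x24 * a5 = 0"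
    and x14: "y1 * b4 - y4 * b1 + x35 * a2 - x25 * a3 + x23 * a5 = 0"
    and x15: "y1 * b5 - y5 * b1 - x34 * a2 + x24 * a3 - x23 * a4 = 0"
    and x23: "y2 * b3 - y3 * b2 + x45 * a1 - x15 * a4 + x14 * a5 = 0"
    and x24: "y2 * b4 - y4 * b2 - x35 * a1 + x15 * a3 - x13 * a5 = 0"
    and x25: "y2 * b5 - y5 * b2 + x34 * a1 - x14 * a3 + x13 * a4 = 0"
    and x34: "y3 * b4 - y4 * b3 + x25 * a1 - x15 * a2 + x12 * a5 = 0"
    and x35: "y3 * b5 - y5 * b3 - x24 * a1 + x14 * a2 - x12 * a4 = 0"
    and x45: "y4 * b5 - y5 * b4 + x23 * a1 - x13 * a2 + x12 * a3 = 0"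
    and N: "a1 * b1 + a2 * b2 + a3 * b3 + a4 * b4 + a5 * b5 \<noteq> 0"
  shows "x0 = 0 \<and> x12 = 0 \<and> x13 = 0 \<and> x14 = 0 \<and> x15 = 0 \<and> x23 = 0
    \<and> x24 = 0 \<and> x25 = 0 \<and> x34 = 0 \<and> x35 = 0 \<and> x45 = 0
    \<and> y1 = 0 \<and> y2 = 0 \<and> y3 = 0 \<and> y4 = 0 \<and> y5 = 0"
proof -
  let ?N = "a1 * b1 + a2 * b2 + a3 * b3 + a4 * b4 + a5 * b5"
  have "x0 * ?N = 0" using y1 y2 y3 y4 y5 by algebra
  then have 0: "x0 = 0" using N by simp
  have "y1 * ?N = 0" using x0 x12 x13 x14 x15 by algebra
  then have Y1: "y1 = 0" using N by simp
  have "y2 * ?N = 0" using x0 x12 x23 x24 x25 by algebra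
  then have Y2: "y2 = 0" using N by simp
  have "y3 * ?N = 0" using x0 x13 x23 x34 x35 by algebra
  then have Y3: "y3 = 0" using N by simp
  have "y4 * ?N = 0" using x0 x14 x24 x34 x45 by algebra
  then have Y4: "y4 = 0" using N by simp
  have "y5 * ?N = 0" using x0 x15 x25 x35 x45 by algebra
  then have Y5: "y5 = 0" using N by simp
  have "x12 * ?N = 0" using x45 x35 x34 y1 y2 unfolding 0 Y1 Y2 Y3 Y4 Y5 by algebra
  then have X12: "x12 = 0" using N by simp
  have "x13 * ?N = 0" using x45 x25 x24 y1 y3 unfolding 0 Y1 Y2 Y3 Y4 Y5 by algebra
  then have X13: "x13 = 0" using N by simp
  have "x14 * ?N = 0" using x35 x25 x23 y1 y4 unfolding 0 Y1 Y2 Y3 Y4 Y5 by algebra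
  then have X14: "x14 = 0" using N by simp
  have "x15 * ?N = 0" using x34 x24 x23 y1 y5 unfolding 0 Y1 Y2 Y3 Y4 Y5 by algebra
  then have X15: "x15 = 0" using N by simp
  have "x23 * ?N = 0" using x45 x15 x14 y2 y3 unfolding 0 Y1 Y2 Y3 Y4 Y5 by algebra
  then have X23: "x23 = 0" using N by simp
  have "x24 * ?N = 0" using x35 x15 x13 y2 y4 unfolding 0 Y1 Y2 Y3 Y4 Y5 by algebra
  then have X24: "x24 = 0" using N by simp
  have "x25 * ?N = 0" using x34 x14 x13 y2 y5 unfolding 0 Y1 Y2 Y3 Y4 Y5 by algebra
  then have X25: "x25 = 0" using N by simp
  have "x34 * ?N = 0" using x25 x15 x12 y3 y4 unfolding 0 Y1 Y2 Y3 Y4 Y5 by algebra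
  then have X34: "x34 = 0" using N by simp
  have "x35 * ?N = 0" using x24 x14 x12 y3 y5 unfolding 0 Y1 Y2 Y3 Y4 Y5 by algebra
  then have X35: "x35 = 0" using N by simp
  have "x45 * ?N = 0" using x23 x13 x12 y4 y5 unfolding 0 Y1 Y2 Y3 Y4 Y5 by algebra
  then have X45: "x45 = 0" using N by simp
  show ?thesis using 0 X12 X13 X14 X15 X23 X24 X25 X34 X35 X45 Y1 Y2 Y3 Y4 Y5 by simp
qed

lemma gradient_spinors:
  "cubic_polar v v (unit Lx0) = 2 * (var (Ly 1) v * var (La 1) v + var (Ly 2) v * var (La 2) v
     + var (Ly 3) v * var (La 3) v + var (Ly 4) v * var (La 4) v + var (Ly 5) v * var (La 5) v)"
  "cubic_polar v v (unit (Ly 1)) = 2 * (var Lx0 v * var (La 1) v + var (Lx 1 2) v * var (Lb 2) v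
     + var (Lx 1 3) v * var (Lb 3) v + var (Lx 1 4) v * var (Lb 4) v + var (Lx 1 5) v * var (Lb 5) v)"
  "cubic_polar v v (unit (Ly 2)) = 2 * (var Lx0 v * var (La 2) v - var (Lx 1 2) v * var (Lb 1) v
     + var (Lx 2 3) v * var (Lb 3) v + var (Lx 2 4) v * var (Lb 4) v + var (Lx 2 5) v * var (Lb 5) v)"
  "cubic_polar v v (unit (Ly 3)) = 2 * (var Lx0 v * var (La 3) v - var (Lx 1 3) v * var (Lb 1) v
     - var (Lx 2 3) v * var (Lb 2) v + var (Lx 3 4) v * var (Lb 4) v + var (Lx 3 5) v * var (Lb 5) v)"
  "cubic_polar v v (unit (Ly 4)) = 2 * (var Lx0 v * var (La 4) v - var (Lx 1 4) v * var (Lb 1) v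
     - var (Lx 2 4) v * var (Lb 2) v - var (Lx 3 4) v * var (Lb 3) v + var (Lx 4 5) v * var (Lb 5) v)"
  "cubic_polar v v (unit (Ly 5)) = 2 * (var Lx0 v * var (La 5) v - var (Lx 1 5) v * var (Lb 1) v
     - var (Lx 2 5) v * var (Lb 2) v - var (Lx 3 5) v * var (Lb 3) v - var (Lx 4 5) v * var (Lb 4) v)"
  "cubic_polar v v (unit (Lx 1 2)) = 2 * (var (Ly 1) v * var (Lb 2) v - var (Ly 2) v * var (Lb 1) v
     + var (Lx 4 5) v * var (La 3) v - var (Lx 3 5) v * var (La 4) v + var (Lx 3 4) v * var (La 5) v)"
  "cubic_polar v v (unit (Lx 1 3)) = 2 * (var (Ly 1) v * var (Lb 3) v - var (Ly 3) v * var (Lb 1) v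
     - var (Lx 4 5) v * var (La 2) v + var (Lx 2 5) v * var (La 4) v - var (Lx 2 4) v * var (La 5) v)"
  "cubic_polar v v (unit (Lx 1 4)) = 2 * (var (Ly 1) v * var (Lb 4) v - var (Ly 4) v * var (Lb 1) v
     + var (Lx 3 5) v * var (La 2) v - var (Lx 2 5) v * var (La 3) v + var (Lx 2 3) v * var (La 5) v)"
  "cubic_polar v v (unit (Lx 1 5)) = 2 * (var (Ly 1) v * var (Lb 5) v - var (Ly 5) v * var (Lb 1) v
     - var (Lx 3 4) v * var (La 2) v + var (Lx 2 4) v * var (La 3) v - var (Lx 2 3) v * var (La 4) v)"
  "cubic_polar v v (unit (Lx 2 3)) = 2 * (var (Ly 2) v * var (Lb 3) v - var (Ly 3) v * var (Lb 2) v
     + var (Lx 4 5) v * var (La 1) v - var (Lx 1 5) v * var (La 4) v + var (Lx 1 4) v * var (La 5) v)"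
  "cubic_polar v v (unit (Lx 2 4)) = 2 * (var (Ly 2) v * var (Lb 4) v - var (Ly 4) v * var (Lb 2) v
     - var (Lx 3 5) v * var (La 1) v + var (Lx 1 5) v * var (La 3) v - var (Lx 1 3) v * var (La 5) v)"
  "cubic_polar v v (unit (Lx 2 5)) = 2 * (var (Ly 2) v * var (Lb 5) v - var (Ly 5) v * var (Lb 2) v
     + var (Lx 3 4) v * var (La 1) v - var (Lx 1 4) v * var (La 3) v + var (Lx 1 3) v * var (La 4) v)"
  "cubic_polar v v (unit (Lx 3 4)) = 2 * (var (Ly 3) v * var (Lb 4) v - var (Ly 4) v * var (Lb 3) v
     + var (Lx 2 5) v * var (La 1) v - var (Lx 1 5) v * var (La 2) v + var (Lx 1 2) v * var (La 5) v)"
  "cubic_polar v v (unit (Lx 3 5)) = 2 * (var (Ly 3) v * var (Lb 5) v - var (Ly 5) v * var (Lb 3) v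
     - var (Lx 2 4) v * var (La 1) v + var (Lx 1 4) v * var (La 2) v - var (Lx 1 2) v * var (La 4) v)"
  "cubic_polar v v (unit (Lx 4 5)) = 2 * (var (Ly 4) v * var (Lb 5) v - var (Ly 5) v * var (Lb 4) v
     + var (Lx 2 3) v * var (La 1) v - var (Lx 1 3) v * var (La 2) v + var (Lx 1 2) v * var (La 3) v)"
  by (simp_all add: cubic_evaluation two_Suc algebra_simps)

lemma clifford_spinor_zero:
  assumes "\<forall>l\<in>spinor_labels. cubic_polar v v (unit l) = 0"
    and "(\<Sum>i = 1..5. var (La i) v * var (Lb i) v) \<noteq> 0"
  shows "\<forall>l\<in>spinor_labels. var l v = 0"
proof -
  have z: "r = 0" if "cubic_polar v v (unit l) = 2 * r" "l \<in> spinor_labels" for l r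
    using assms(1) that by simp
  have "var Lx0 v = 0 \<and> var (Lx 1 2) v = 0 \<and> var (Lx 1 3) v = 0 \<and> var (Lx 1 4) v = 0 \<and> var (Lx 1 5) v = 0
      \<and> var (Lx 2 3) v = 0 \<and> var (Lx 2 4) v = 0 \<and> var (Lx 2 5) v = 0 \<and> var (Lx 3 4) v = 0
      \<and> var (Lx 3 5) v = 0 \<and> var (Lx 4 5) v = 0 \<and> var (Ly 1) v = 0 \<and> var (Ly 2) v = 0 \<and> var (Ly 3) v = 0
      \<and> var (Ly 4) v = 0 \<and> var (Ly 5) v = 0"
    by (rule clifford_kernel[of "var (Ly 1) v" "var (La 1) v" "var (Ly 2) v" "var (La 2) v" "var (Ly 3) v"
      "var (La 3) v" "var (Ly 4) v" "var (La 4) v" "var (Ly 5) v" "var (La 5) v"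
      "var Lx0 v" "var (Lx 1 2) v" "var (Lb 2) v" "var (Lx 1 3) v" "var (Lb 3) v"
      "var (Lx 1 4) v" "var (Lb 4) v" "var (Lx 1 5) v" "var (Lb 5) v" "var (Lb 1) v"
      "var (Lx 2 3) v" "var (Lx 2 4) v" "var (Lx 2 5) v" "var (Lx 3 4) v"
      "var (Lx 3 5) v" "var (Lx 4 5) v"];
      (rule assms(2)[unfolded sum_5] | (rule z, rule gradient_spinors, simp add: spinor_labels_eq)))
  then show ?thesis unfolding spinor_labels_eq by simp
qed

text \<open>
  In the hyperplane \<open>w = 0\<close> the forms \<open>F\<close> and \<open>F_C\<close> agree, also after moving along another coordinate.
\<close>

lemma partial_F:
  assumes "var Lw v = 0" "k \<noteq> Abs_coord Lw" shows "partial k F v = cubic_polar v v (axis k 1) / 2"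
proof -
  have "var Lw (v + t *s axis k 1) = 0" for t
    using assms by (simp add: var_def axis_def)
  then have "F (v + t *s axis k 1) = F_C (v + t *s axis k 1)" for t by (simp add: F_C_def)
  then have "partial k F v = partial k F_C v" by (simp add: partial_def)
  then show ?thesis by (simp add: partial_F_C)
qed

lemma gradient_Lw: "cubic_polar v v (unit Lw) = - 2 * (\<Sum>i = 1..5. var (La i) v * var (Lb i) v)"
  by (simp add: cubic_evaluation two_Suc)

lemma Lam_eq: "Lam = {L \<in> PP. \<forall>v\<in>L. var Lw v = 0 \<and> (\<forall>l\<in>spinor_labels. var l v = 0)}"
  unfolding Lam_def zero_locus_def spinor_labels_def by fastforce

lemma Sing_eq: "Sing_V_F = {L \<in> PP. \<forall>v\<in>L. var Lw v = 0 \<and>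
    (\<forall>k. k \<noteq> Abs_coord Lw \<longrightarrow> cubic_polar v v (axis k 1) = 0)}"
  unfolding Sing_V_F_def zero_locus_def
  by (intro Collect_cong conj_cong refl ball_cong) (auto simp: partial_F)

lemma Lam_subspace:
  "Lam = {L \<in> PP. L \<subseteq> {v. var Lw v = 0 \<and> (\<forall>l\<in>spinor_labels. var l v = 0)}}"
  unfolding Lam_eq by blast

lemma gradient_vector_part:
  assumes "\<forall>l\<in>spinor_labels. var l v = 0" "var Lw v = 0" "l \<in> labels" "l \<noteq> Lw"
  shows "cubic_polar v v (unit l) = 0"
proof -
  have q: "q i v = 0" "q' i v = 0" if "i \<in> {1..5}" for i
    using q_cong[of v 0 i] assms(1) that
    by (simp_all add: q_def q'_def Pf_def pfaffian4_def P_entry_def)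
  have "\<forall>l\<in>spinor_labels. cubic_polar v v (unit l) = 0"
    using assms(1) unfolding spinor_labels_eq by (simp add: gradient_spinors del: One_nat_def)
  then show ?thesis
    using assms(2-4) q unfolding labels_decomp by (auto simp: gradient_La gradient_Lb)
qed

text \<open>
  Of the equations of the Cayley plane only the one for \<open>w\<close>, that is \<open>\<Sum>i. a i * b i = 0\<close>, is
  not among those of the singular locus.  Where it fails, Clifford multiplication forces the spinor part to
  vanish.
\<close>

lemma Sing_decomp: "Sing_V_F = (cayley \<inter> V (var Lw)) \<union> Lam"
proof (intro equalityI subsetI)
  fix L assume L: "L \<in> Sing_V_F"
  then obtain v where v: "v \<noteq> 0" "L = vec.span {v}" by (auto simp: Sing_eq in_PP)
  have vL: "v \<in> L" by (simp add: v vec.span_base)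
  have w: "var Lw v = 0" and D: "\<And>l. l \<in> labels \<Longrightarrow> l \<noteq> Lw \<Longrightarrow> cubic_polar v v (unit l) = 0"
    using L vL by (auto simp: Sing_eq Abs_coord_inject)
  have W: "L \<in> V (var Lw)"
    unfolding v(2) by (subst in_zero_locus[OF v(1)]) (use homogeneous_var w in auto)
  show "L \<in> (cayley \<inter> V (var Lw)) \<union> Lam"
  proof (cases "cubic_polar v v (unit Lw) = 0")
    case True
    then have "\<forall>l\<in>labels. cubic_polar v v (unit l) = 0" using D by blast
    then have "\<forall>k. cubic_polar v v (axis k 1) = 0" unfolding all_coord .
    then have "L \<in> cayley"
      unfolding v(2) cayley_def
      by (subst in_zero_locus[OF v(1)]) (use homogeneous_partial in \<open>auto simp: partial_F_C\<close>)
    then show ?thesis using W by blast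
  next
    case False
    have "\<forall>l\<in>spinor_labels. var l v = 0"
    proof (rule clifford_spinor_zero)
      show "\<forall>l\<in>spinor_labels. cubic_polar v v (unit l) = 0"
        using D by (auto simp: labels_decomp spinor_labels_def)
      show "(\<Sum>i = 1..5. var (La i) v * var (Lb i) v) \<noteq> 0"
        using False by (simp add: gradient_Lw)
    qed
    then have "L \<in> Lam" using w v by (auto simp: Lam_eq in_PP span_point[of v])
    then show ?thesis ..
  qed
next
  fix L assume "L \<in> (cayley \<inter> V (var Lw)) \<union> Lam"
  then show "L \<in> Sing_V_F"
  proof
    assume "L \<in> cayley \<inter> V (var Lw)"
    then show ?thesis by (auto simp: Sing_eq cayley_def zero_locus_def partial_F_C)
  next
    assume L: "L \<in> Lam"
    have "cubic_polar v v (axis k 1) = 0" if "v \<in> L" "k \<noteq> Abs_coord Lw" for v k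
    proof -
      have "Rep_coord k \<noteq> Lw" using that(2) by (metis Rep_coord_inverse)
      then have "cubic_polar v v (unit (Rep_coord k)) = 0"
        using L that by (intro gradient_vector_part) (auto simp: Lam_eq Rep_coord Rep_coord_inverse)
      then show ?thesis by (simp add: Rep_coord_inverse)
    qed
    then show ?thesis using L by (auto simp: Sing_eq Lam_eq)
  qed
qed

lemma Lam_linear: "projective_linear 9 Lam"
proof -
  let ?U = "{v. var Lw v = 0 \<and> (\<forall>l\<in>spinor_labels. var l v = 0)} :: cvec set"
  let ?K = "Abs_coord ` (La ` {1..5} \<union> Lb ` {1..5})"
  have "vec.subspace ?U" unfolding vec.subspace_def by simp
  have "(\<forall>k. k \<notin> ?K \<longrightarrow> v $ k = 0) \<longleftrightarrow> v \<in> ?U" for v :: cvec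
  proof -
    have "Abs_coord l \<notin> ?K \<longleftrightarrow> l \<in> spinor_labels \<or> l = Lw" if "l \<in> labels" for l
      using that by (auto simp: labels_decomp spinor_labels_def Abs_coord_inject image_iff)
    then show ?thesis
      unfolding all_coord by (auto simp: var_def labels_decomp)
  qed
  then have U: "?U = {v. \<forall>k. k \<notin> ?K \<longrightarrow> v $ k = 0}" by blast
  have "inj_on Abs_coord (La ` {1..5} \<union> Lb ` {1..5})"
    by (rule inj_onI) (auto simp: Abs_coord_inject)
  then have "card ?K = card (La ` {1..5} \<union> Lb ` {1..5})" by (rule card_image)
  also have "\<dots> = 10" by (subst card_Un_disjoint) (auto simp: card_image inj_on_def)
  finally have "vec.dim ?U = 9 + 1" unfolding U dim_substandard_cart by simp
  then show ?thesis
    unfolding projective_linear_def Lam_subspace using \<open>vec.subspace ?U\<close> by blast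
qed

lemma closed_w: "zariski_closed (V (var Lw))"
  unfolding zariski_closed_def using homogeneous_var by blast

lemma closed_Lam: "zariski_closed Lam"
  unfolding zariski_closed_def Lam_def
  by (rule exI, rule conjI[OF _ refl]) (auto intro!: exI homogeneous_var)

lemma closed_Int: "zariski_closed Z \<Longrightarrow> zariski_closed Z' \<Longrightarrow> zariski_closed (Z \<inter> Z')"
  unfolding zariski_closed_def by (metis Un_iff zero_locus_Un)

text \<open>
  A larger irreducible closed set in the singular locus would lie in \<open>Lam\<close> or in the Cayley plane; the
  second is impossible because the point with \<open>a1 = b1 = 1\<close> and all other coordinates 0 is not on the
  Cayley plane.
\<close>

lemma Lam_component: "irreducible_component Lam Sing_V_F"
  unfolding irreducible_component_def
proof (intro conjI allI impI)
  let ?p = "unit (La 1) + unit (Lb 1) :: cvec"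
  let ?U = "{v. var Lw v = 0 \<and> (\<forall>l\<in>spinor_labels. var l v = 0)} :: cvec set"
  have pU: "?p \<in> ?U" by (auto simp: spinor_labels_def)
  have "var (La 1) ?p \<noteq> var (La 1) 0" by simp
  then have p0: "?p \<noteq> 0" by metis
  have U: "vec.subspace ?U" unfolding vec.subspace_def by simp
  show "zariski_closed Lam" by (rule closed_Lam)
  show "zariski_irreducible Lam"
    unfolding Lam_subspace by (rule linear_irreducible[OF U pU p0])
  show "Lam \<subseteq> Sing_V_F" unfolding Sing_decomp by blast
  have "vec.span {?p} \<in> Lam"
    unfolding Lam_subspace using p0 pU U by (auto simp: in_PP vec.span_minimal)
  moreover have "cubic_polar ?p ?p (unit Lw) \<noteq> 0"
    unfolding gradient_Lw by (simp add: sum_5)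
  then have "vec.span {?p} \<notin> cayley" using in_cayley[OF p0] by blast
  ultimately have nsub: "\<not> Lam \<subseteq> cayley \<inter> V (var Lw)" by blast
  fix Z' assume Z': "zariski_closed Z'" "zariski_irreducible Z'" "Lam \<subseteq> Z'" "Z' \<subseteq> Sing_V_F"
  then have "Z' \<subseteq> cayley \<inter> V (var Lw) \<or> Z' \<subseteq> Lam"
    unfolding zariski_irreducible_def Sing_decomp
    using closed_Int[OF closed_cayley closed_w] closed_Lam by blast
  then show "Z' = Lam" using nsub Z'(3) by blast
qed

lemma rep27: "E6_rep27 e6 f6 h6"
  unfolding E6_rep27_def
proof (intro conjI ballI allI impI)
  fix i j assume ij: "i \<in> {1..6::nat}" "j \<in> {1..6::nat}"
  show "bracket (h6 i) (h6 j) = 0" by (rule bracket_h_h)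
  show "bracket (e6 i) (f6 j) = (if i = j then h6 i else 0)"
    using ij bracket_e_f bracket_e_f_same by simp
  show "bracket (h6 i) (e6 j) = mat (of_int (E6_cartan i j)) ** e6 j" using ij bracket_h_e by blast
  show "bracket (h6 i) (f6 j) = mat (of_int (- E6_cartan i j)) ** f6 j" using ij bracket_h_f by blast
  show "(bracket (e6 i) ^^ nat (1 - E6_cartan i j)) (e6 j) = 0" if "i \<noteq> j" using ij that serre_e by blast
  show "(bracket (f6 i) ^^ nat (1 - E6_cartan i j)) (f6 j) = 0" if "i \<noteq> j" using ij that serre_f by blast
qed (use rep_irreducible in blast)

lemma V_F_section: "V_F = V F_C \<inter> V (var Lw)"
  by (auto simp: V_F_def zero_locus_def F_C_def)

theorem theorem3p3:
  shows "\<exists>e f h. E6_rep27 e f h \<and>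
     (\<exists>OP2. is_Cayley_plane (E6_group e f h) OP2 \<and>
        (is_Cartan_cubic (E6_group e f h) (V F_C) \<and>
         V_F = V F_C \<inter> V (var Lw)) \<and>
        (Sing_V_F = (OP2 \<inter> V (var Lw)) \<union> Lam \<and>
         projective_linear 9 Lam \<and>
         irreducible_component Lam Sing_V_F))"
  using rep27 cayley_plane Cartan_cubic V_F_section Sing_decomp Lam_linear Lam_component by blast

end
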